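(* Let $C$ be the conjugacy class of an odd permutation $\sigma\in\mathcal S_d$. If $f_C\geq 2$, then there is a constant $N=N_C$ with $$N_C<3^{d-3}(2d-1)(d-1)m_C+n_Ck_C+1$$ such that any element $s=\widetilde s\cdot\overline s\in\Sigma_d^{\mathcal S_d}$, where $\widetilde s\in\Sigma_d$ and $\overline s\in S_C$, is uniquely determined by $\tau(s)$ and $\alpha(s)$ if $ln(\overline s)\geq N$. That is, if $s=\widetilde s\cdot\overline s\in\Sigma_d^{\mathcal S_d}$ with $\overline s\in S_C$, $ln(\overline s)\geq N$, and $s'\in\Sigma_d^{\mathcal S_d}$ satisfies $\tau(s')=\tau(s)$ and $\alpha(s')=\alpha(s)$, then $s'=s$.
   Context: $\mathcal S_d$ is the symmetric group acting on $I_d=\{1,\dots,d\}$. Factorization semigroups. Let $G$ be a group and $O\subset G$ a subset invariant under inner automorphisms. The semigroup $S_O=S(G,O)$ is generated by the alphabet $\{x_g\mid g\in O\}$ subject to the relations $x_{g_1}\cdot x_{g_2}=x_{g_2}\cdot x_{g_2^{-1}g_1g_2}=x_{g_1g_2g_1^{-1}}\cdot x_{g_1}$ for all $g_1,g_2\in O$, and $x_{g_1}\cdot x_{\mathbf 1}=x_{g_1}$ (if $\mathbf 1\in O$). The product homomorphism $\alpha:S_O\to G$ is given by $\alpha(x_g)=g$. Let $O\setminus\{\mathbf 1\}=C_1\sqcup\dots\sqcup C_m$ be the decomposition into conjugacy classes of $G$. For $s=x_{g_1}\cdots x_{g_n}\in S_O$, the type of $s$ is $\tau(s)=n_1C_1+\dots+n_mC_m$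 (an element of the free abelian semigroup generated by $C_1,\dots,C_m$), where $n_i$ is the number of factors $x_{g_j}$ with $g_j\in C_i$; the length is $ln(s)=\sum_i n_i$; and $G_s=\langle g_1,\dots,g_n\rangle$ is the subgroup of $G$ generated by the factors. These are well defined. Write $\Sigma_d=S(\mathcal S_d,\mathcal S_d)$, $\Sigma_d^{\mathcal S_d}=\{s\in\Sigma_d\mid G_s=\mathcal S_d\}$, and, for a conjugacy class $C\subset\mathcal S_d$, $S_C=S(\mathcal S_d,C)$, regarded as the subsemigroup of $\Sigma_d$ generated by $x_g$, $g\in C$. For the conjugacy class $C$ of $\sigma\in\mathcal S_d$: $n_C$ is the order of $\sigma$, $k_C=|C|$, and $f_C$ is the number of elements of $I_d$ fixed by $\sigma$. If $\sigma$ is odd and $f_C\geq2$, then $m_C$ denotes the minimal number (counted with multiplicities) of permutations of $C\cap\mathcal S_{d-2}$ needed to express the transposition $(1,2)$ as a product $(1,2)=\sigma_1\cdots\sigma_{m_C}$ with all $\sigma_i\in C\cap\mathcal S_{d-2}$, where $\mathcal S_{d-2}\subset\mathcal S_d$ is the subgroup of permutations fixing $d-1$ and $d$. *)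

theory Defs
  imports "HOL-Algebra.Algebra" "HOL-Library.Multiset"
begin

definition conj_class :: "('a, 'b) monoid_scheme \<Rightarrow> 'a \<Rightarrow> 'a set"
  where "conj_class G g = {h \<otimes>\<^bsub>G\<^esub> g \<otimes>\<^bsub>G\<^esub> inv\<^bsub>G\<^esub> h | h. h \<in> carrier G}"

definition word_prod :: "('a, 'b) monoid_scheme \<Rightarrow> 'a list \<Rightarrow> 'a"
  where "word_prod G w = foldr (\<otimes>\<^bsub>G\<^esub>) w \<one>\<^bsub>G\<^esub>"


section \<open>Factorization semigroups\<close>

text \<open>The semigroup \<open>S(G,\<O>)\<close> is the set of nonempty words over \<open>\<O>\<close> modulo the congruence
  generated by the defining relations; the letter $x_g$ is represented by $g$.
  It is a semigroup without an adjoined empty word: if \<open>1 \<in> \<O>\<close>, then $x_1$ is its unit.\<close>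

inductive fact_cong :: "('a, 'b) monoid_scheme \<Rightarrow> 'a set \<Rightarrow> 'a list \<Rightarrow> 'a list \<Rightarrow> bool"
  for G and \<O>
  where
    refl: "w \<noteq> [] \<Longrightarrow> set w \<subseteq> \<O> \<Longrightarrow> fact_cong G \<O> w w"
  | sym: "fact_cong G \<O> u v \<Longrightarrow> fact_cong G \<O> v u"
  | trans: "fact_cong G \<O> u v \<Longrightarrow> fact_cong G \<O> v w \<Longrightarrow> fact_cong G \<O> u w"
  | append: "fact_cong G \<O> u u' \<Longrightarrow> fact_cong G \<O> v v' \<Longrightarrow> fact_cong G \<O> (u @ v) (u' @ v')"
  | right: "g1 \<in> \<O> \<Longrightarrow> g2 \<in> \<O> \<Longrightarrow> fact_cong G \<O> [g1, g2] [g2, inv\<^bsub>G\<^esub> g2 \<otimes>\<^bsub>G\<^esub> g1 \<otimes>\<^bsub>G\<^esub> g2]"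
  | left: "g1 \<in> \<O> \<Longrightarrow> g2 \<in> \<O> \<Longrightarrow> fact_cong G \<O> [g1, g2] [g1 \<otimes>\<^bsub>G\<^esub> g2 \<otimes>\<^bsub>G\<^esub> inv\<^bsub>G\<^esub> g1, g1]"
  | unit: "g1 \<in> \<O> \<Longrightarrow> \<one>\<^bsub>G\<^esub> \<in> \<O> \<Longrightarrow> fact_cong G \<O> [g1, \<one>\<^bsub>G\<^esub>] [g1]"

definition fact_rel :: "('a, 'b) monoid_scheme \<Rightarrow> 'a set \<Rightarrow> ('a list \<times> 'a list) set"
  where "fact_rel G \<O> = {(u, v). fact_cong G \<O> u v}"

definition fact_semigroup :: "('a, 'b) monoid_scheme \<Rightarrow> 'a set \<Rightarrow> 'a list set set"
  where "fact_semigroup G \<O> = {w. w \<noteq> [] \<and> set w \<subseteq> \<O>} // fact_rel G \<O>"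

definition fact_gen :: "('a, 'b) monoid_scheme \<Rightarrow> 'a set \<Rightarrow> 'a \<Rightarrow> 'a list set"
  where "fact_gen G \<O> g = fact_rel G \<O> `` {[g]}"

definition fact_mult ::
    "('a, 'b) monoid_scheme \<Rightarrow> 'a set \<Rightarrow> 'a list set \<Rightarrow> 'a list set \<Rightarrow> 'a list set"
  where "fact_mult G \<O> s t = (\<Union>u\<in>s. \<Union>v\<in>t. fact_rel G \<O> `` {u @ v})"

text \<open>The subsemigroup of \<open>S(G,\<O>)\<close> generated by the $x_g$ with $g \in A$.\<close>

inductive_set fact_sub :: "('a, 'b) monoid_scheme \<Rightarrow> 'a set \<Rightarrow> 'a set \<Rightarrow> 'a list set set"
  for G and \<O> and A
  where
    gen: "g \<in> A \<Longrightarrow> fact_gen G \<O> g \<in> fact_sub G \<O> A"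
  | mult: "s \<in> fact_sub G \<O> A \<Longrightarrow> t \<in> fact_sub G \<O> A \<Longrightarrow> fact_mult G \<O> s t \<in> fact_sub G \<O> A"

text \<open>The invariants of an element are those of any word in it; the lemmas ending in
  \<open>_class\<close> below show that they do not depend on the word.  The type
  $n_1C_1 + \dots + n_mC_m$ is the multiset of conjugacy classes of the non-identity factors.\<close>

definition word_type :: "('a, 'b) monoid_scheme \<Rightarrow> 'a list \<Rightarrow> 'a set multiset"
  where "word_type G w =
    image_mset (conj_class G) (filter_mset (\<lambda>g. g \<noteq> \<one>\<^bsub>G\<^esub>) (mset w))"

definition fact_alpha :: "('a, 'b) monoid_scheme \<Rightarrow> 'a list set \<Rightarrow> 'a"
  where "fact_alpha G s = the_elem (word_prod G ` s)"

definition fact_type :: "('a, 'b) monoid_scheme \<Rightarrow> 'a list set \<Rightarrow> 'a set multiset"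
  where "fact_type G s = the_elem (word_type G ` s)"

definition fact_length :: "('a, 'b) monoid_scheme \<Rightarrow> 'a list set \<Rightarrow> nat"
  where "fact_length G s = size (fact_type G s)"

definition fact_subgroup :: "('a, 'b) monoid_scheme \<Rightarrow> 'a list set \<Rightarrow> 'a set"
  where "fact_subgroup G s = the_elem ((\<lambda>w. generate G (set w)) ` s)"


section \<open>Well-definedness\<close>

locale factorization_semigroup = group G for G (structure) +
  fixes \<O>
  assumes O_carrier: "\<O> \<subseteq> carrier G"
    and O_conj: "\<lbrakk>g \<in> \<O>; h \<in> carrier G\<rbrakk> \<Longrightarrow> h \<otimes> g \<otimes> inv h \<in> \<O>"
begin

lemma O_conj': "\<lbrakk>g \<in> \<O>; h \<in> carrier G\<rbrakk> \<Longrightarrow> inv h \<otimes> g \<otimes> h \<in> \<O>"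
  using O_conj[of g "inv h"] by simp

lemma fact_cong_words:
  "fact_cong G \<O> u v \<Longrightarrow> u \<noteq> [] \<and> set u \<subseteq> \<O> \<and> v \<noteq> [] \<and> set v \<subseteq> \<O>"
  by (induction rule: fact_cong.induct) (use O_carrier O_conj O_conj' in auto)

lemma equiv_fact_rel: "equiv {w. w \<noteq> [] \<and> set w \<subseteq> \<O>} (fact_rel G \<O>)"
proof (rule equivI)
  show "refl_on {w. w \<noteq> [] \<and> set w \<subseteq> \<O>} (fact_rel G \<O>)"
    by (auto simp: refl_on_def fact_rel_def intro: fact_cong.refl)
  show "fact_rel G \<O> \<subseteq> {w. w \<noteq> [] \<and> set w \<subseteq> \<O>} \<times> {w. w \<noteq> [] \<and> set w \<subseteq> \<O>}"
    using fact_cong_words by (auto simp: fact_rel_def)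
  show "Relation.sym (fact_rel G \<O>)"
    by (auto simp: sym_def fact_rel_def intro: fact_cong.sym)
  show "Relation.trans (fact_rel G \<O>)"
    by (auto simp: trans_def fact_rel_def intro: fact_cong.trans)
qed

lemma fact_mult_class:
  assumes "u \<noteq> []" "set u \<subseteq> \<O>" "v \<noteq> []" "set v \<subseteq> \<O>"
  shows "fact_mult G \<O> (fact_rel G \<O> `` {u}) (fact_rel G \<O> `` {v}) = fact_rel G \<O> `` {u @ v}"
proof -
  have "fact_cong G \<O> (u @ v) w"
    if "fact_cong G \<O> u u'" "fact_cong G \<O> v v'" "fact_cong G \<O> (u' @ v') w" for u' v' w
    using that by (blast intro: fact_cong.append fact_cong.trans)
  moreover have "fact_cong G \<O> u u" "fact_cong G \<O> v v"
    using assms by (auto intro: fact_cong.refl)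
  ultimately show ?thesis
    by (auto simp: fact_mult_def fact_rel_def)
qed

lemma word_prod_closed: "set w \<subseteq> carrier G \<Longrightarrow> word_prod G w \<in> carrier G"
  by (induction w) (auto simp: word_prod_def)

lemma word_prod_append:
  assumes "set u \<subseteq> carrier G" "set v \<subseteq> carrier G"
  shows "word_prod G (u @ v) = word_prod G u \<otimes> word_prod G v"
  using assms
proof (induction u)
  case Nil
  then show ?case using word_prod_closed[of v] by (simp add: word_prod_def)
next
  case (Cons g u)
  then show ?case
    using word_prod_closed[of u] word_prod_closed[of v] by (simp add: word_prod_def m_assoc)
qed

lemma word_prod_cong: "fact_cong G \<O> u v \<Longrightarrow> word_prod G u = word_prod G v"
proof (induction rule: fact_cong.induct)
  case (append u u' v v')
  then have "set u \<subseteq> carrier G" "set u' \<subseteq> carrier G" "set v \<subseteq> carrier G" "set v' \<subseteq> carrier G"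
    using fact_cong_words O_carrier by blast+
  with append show ?case by (simp add: word_prod_append)
next
  case (right g1 g2)
  then have "g1 \<in> carrier G" "g2 \<in> carrier G" using O_carrier by auto
  then show ?case by (simp add: word_prod_def m_assoc[symmetric])
next
  case (left g1 g2)
  then have "g1 \<in> carrier G" "g2 \<in> carrier G" using O_carrier by auto
  then show ?case by (simp add: word_prod_def m_assoc)
qed (auto simp: word_prod_def)

lemma conj_class_conj_subset:
  assumes "g \<in> carrier G" "h \<in> carrier G"
  shows "conj_class G (h \<otimes> g \<otimes> inv h) \<subseteq> conj_class G g"
proof
  fix x assume "x \<in> conj_class G (h \<otimes> g \<otimes> inv h)"
  then obtain k where k: "k \<in> carrier G" "x = k \<otimes> (h \<otimes> g \<otimes> inv h) \<otimes> inv k"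
    by (auto simp: conj_class_def)
  then have "x = (k \<otimes> h) \<otimes> g \<otimes> inv (k \<otimes> h)"
    using assms by (simp add: m_assoc inv_mult_group)
  moreover have "k \<otimes> h \<in> carrier G" using assms k by simp
  ultimately show "x \<in> conj_class G g" by (auto simp only: conj_class_def)
qed

lemma conj_conj_inv:
  assumes "g \<in> carrier G" "h \<in> carrier G"
  shows "inv h \<otimes> (h \<otimes> g \<otimes> inv h) \<otimes> h = g"
proof -
  have "inv h \<otimes> (h \<otimes> g \<otimes> inv h) \<otimes> h = (inv h \<otimes> h) \<otimes> g \<otimes> (inv h \<otimes> h)"
    using assms by (simp only: m_assoc inv_closed m_closed)
  then show ?thesis using assms by simp
qed

lemma conj_class_conj:
  assumes "g \<in> carrier G" "h \<in> carrier G"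
  shows "conj_class G (h \<otimes> g \<otimes> inv h) = conj_class G g"
  using conj_class_conj_subset[of g h] conj_class_conj_subset[of "h \<otimes> g \<otimes> inv h" "inv h"]
    conj_conj_inv[of g h] assms by auto

lemma conj_eq_one_iff:
  assumes "g \<in> carrier G" "h \<in> carrier G"
  shows "h \<otimes> g \<otimes> inv h = \<one> \<longleftrightarrow> g = \<one>"
proof
  assume "h \<otimes> g \<otimes> inv h = \<one>"
  with conj_conj_inv[OF assms] have "inv h \<otimes> \<one> \<otimes> h = g" by simp
  then show "g = \<one>" using assms by simp
qed (use assms in simp)

lemma conj_class_conj':
  assumes "g \<in> carrier G" "h \<in> carrier G"
  shows "conj_class G (inv h \<otimes> g \<otimes> h) = conj_class G g"
  using conj_class_conj[of g "inv h"] assms by simp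

lemma conj_eq_one_iff':
  assumes "g \<in> carrier G" "h \<in> carrier G"
  shows "inv h \<otimes> g \<otimes> h = \<one> \<longleftrightarrow> g = \<one>"
  using conj_eq_one_iff[of g "inv h"] assms by simp

lemma word_type_cong: "fact_cong G \<O> u v \<Longrightarrow> word_type G u = word_type G v"
proof (induction rule: fact_cong.induct)
  case (right g1 g2)
  then have "g1 \<in> carrier G" "g2 \<in> carrier G" using O_carrier by auto
  then show ?case by (simp add: word_type_def conj_class_conj' conj_eq_one_iff')
next
  case (left g1 g2)
  then have "g1 \<in> carrier G" "g2 \<in> carrier G" using O_carrier by auto
  then show ?case by (simp add: word_type_def conj_class_conj conj_eq_one_iff)
qed (auto simp: word_type_def)

lemma generate_eqI:
  assumes "A \<subseteq> carrier G" "B \<subseteq> carrier G" "A \<subseteq> generate G B" "B \<subseteq> generate G A"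
  shows "generate G A = generate G B"
  using assms by (meson generate_is_subgroup generate_subgroup_incl subset_antisym)

lemma generate_Un_cong:
  assumes "A \<subseteq> carrier G" "A' \<subseteq> carrier G" "B \<subseteq> carrier G" "B' \<subseteq> carrier G"
    and "generate G A = generate G A'" "generate G B = generate G B'"
  shows "generate G (A \<union> B) = generate G (A' \<union> B')"
proof (rule generate_eqI)
  have *: "Z \<subseteq> generate G Z" for Z by (auto intro: generate.incl)
  have **: "generate G Z \<subseteq> generate G (Z \<union> W)" "generate G Z \<subseteq> generate G (W \<union> Z)" for Z W
    by (simp_all add: mono_generate)
  show "A \<union> B \<subseteq> generate G (A' \<union> B')"
    using *[of A] *[of B] **(1)[of A' B'] **(2)[of B' A'] assms(5,6) by blast
  show "A' \<union> B' \<subseteq> generate G (A \<union> B)"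
    using *[of A'] *[of B'] **(1)[of A B] **(2)[of B A] assms(5,6) by blast
qed (use assms in auto)

lemma generate_cong: "fact_cong G \<O> u v \<Longrightarrow> generate G (set u) = generate G (set v)"
proof (induction rule: fact_cong.induct)
  case (append u u' v v')
  then have "set u \<subseteq> carrier G" "set u' \<subseteq> carrier G" "set v \<subseteq> carrier G" "set v' \<subseteq> carrier G"
    using fact_cong_words O_carrier by blast+
  with append show ?case unfolding set_append by (intro generate_Un_cong)
next
  case (right g1 g2)
  then have c: "g1 \<in> carrier G" "g2 \<in> carrier G" using O_carrier by auto
  let ?h = "inv g2 \<otimes> g1 \<otimes> g2"
  have "g2 \<otimes> ?h \<otimes> inv g2 \<in> generate G {g2, ?h}"
    by (blast intro: generate.eng generate.incl generate.inv)
  moreover have "g2 \<otimes> ?h \<otimes> inv g2 = g1"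
    using conj_conj_inv[of g1 "inv g2"] c by simp
  moreover have "?h \<in> generate G {g1, g2}"
    by (blast intro: generate.eng generate.incl generate.inv)
  ultimately show ?case
    using c by (intro generate_eqI) (auto intro: generate.incl)
next
  case (left g1 g2)
  then have c: "g1 \<in> carrier G" "g2 \<in> carrier G" using O_carrier by auto
  let ?h = "g1 \<otimes> g2 \<otimes> inv g1"
  have "inv g1 \<otimes> ?h \<otimes> g1 \<in> generate G {?h, g1}"
    by (blast intro: generate.eng generate.incl generate.inv)
  moreover have "inv g1 \<otimes> ?h \<otimes> g1 = g2"
    using c by (rule conj_conj_inv[rotated])
  moreover have "?h \<in> generate G {g1, g2}"
    by (blast intro: generate.eng generate.incl generate.inv)
  ultimately show ?case
    using c by (intro generate_eqI) (auto intro: generate.incl)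
next
  case (unit g1)
  then show ?case
    using O_carrier by (intro generate_eqI) (auto intro: generate.incl generate.one)
qed auto

lemma the_elem_class:
  assumes "w \<noteq> []" "set w \<subseteq> \<O>" "\<And>u v. fact_cong G \<O> u v \<Longrightarrow> f u = f v"
  shows "the_elem (f ` (fact_rel G \<O> `` {w})) = f w"
proof -
  have "fact_cong G \<O> w w" using assms(1,2) by (blast intro: fact_cong.refl)
  moreover have "f v = f w" if "fact_cong G \<O> w v" for v by (rule assms(3)[OF that, symmetric])
  ultimately have "f ` (fact_rel G \<O> `` {w}) = {f w}"
    unfolding fact_rel_def by blast
  then show ?thesis by simp
qed

lemma fact_alpha_class:
  "\<lbrakk>w \<noteq> []; set w \<subseteq> \<O>\<rbrakk> \<Longrightarrow> fact_alpha G (fact_rel G \<O> `` {w}) = word_prod G w"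
  unfolding fact_alpha_def by (rule the_elem_class[OF _ _ word_prod_cong])

lemma fact_type_class:
  "\<lbrakk>w \<noteq> []; set w \<subseteq> \<O>\<rbrakk> \<Longrightarrow> fact_type G (fact_rel G \<O> `` {w}) = word_type G w"
  unfolding fact_type_def by (rule the_elem_class[OF _ _ word_type_cong])

lemma fact_subgroup_class:
  "\<lbrakk>w \<noteq> []; set w \<subseteq> \<O>\<rbrakk> \<Longrightarrow> fact_subgroup G (fact_rel G \<O> `` {w}) = generate G (set w)"
  unfolding fact_subgroup_def by (rule the_elem_class[OF _ _ generate_cong])

end


section \<open>Symmetric groups\<close>

lemma factorization_semigroup_sym_group:
  "factorization_semigroup (sym_group d) (carrier (sym_group d))"
proof -
  interpret group "sym_group d" by (rule sym_group_is_group)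
  show ?thesis by unfold_locales (blast intro: m_closed inv_closed)+
qed

text \<open>Products in \<open>sym_group d\<close> are compositions of maps, applied right to left.\<close>

definition Sigma_sym :: "nat \<Rightarrow> (nat \<Rightarrow> nat) list set set"
  where "Sigma_sym d = fact_semigroup (sym_group d) (carrier (sym_group d))"

definition Sigma_mult ::
    "nat \<Rightarrow> (nat \<Rightarrow> nat) list set \<Rightarrow> (nat \<Rightarrow> nat) list set \<Rightarrow> (nat \<Rightarrow> nat) list set"
  where "Sigma_mult d = fact_mult (sym_group d) (carrier (sym_group d))"

definition Sigma_full :: "nat \<Rightarrow> (nat \<Rightarrow> nat) list set set"
  where "Sigma_full d =
    {s \<in> Sigma_sym d. fact_subgroup (sym_group d) s = carrier (sym_group d)}"

definition Sigma_class :: "nat \<Rightarrow> (nat \<Rightarrow> nat) set \<Rightarrow> (nat \<Rightarrow> nat) list set set"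
  where "Sigma_class d C = fact_sub (sym_group d) (carrier (sym_group d)) C"

definition class_order :: "nat \<Rightarrow> (nat \<Rightarrow> nat) \<Rightarrow> nat"
  where "class_order d \<sigma> = group.ord (sym_group d) \<sigma>"

definition class_fixed :: "nat \<Rightarrow> (nat \<Rightarrow> nat) \<Rightarrow> nat"
  where "class_fixed d \<sigma> = card {i \<in> {1..d}. \<sigma> i = i}"

definition class_card :: "nat \<Rightarrow> (nat \<Rightarrow> nat) \<Rightarrow> nat"
  where "class_card d \<sigma> = card (conj_class (sym_group d) \<sigma>)"

text \<open>Only meaningful for odd \<open>\<sigma>\<close> with at least two fixed points, where such an
  expression of the transposition exists.\<close>

definition class_transp_length :: "nat \<Rightarrow> (nat \<Rightarrow> nat) \<Rightarrow> nat"
  where "class_transp_length d \<sigma> =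
    (LEAST m. \<exists>w. length w = m \<and>
       set w \<subseteq> conj_class (sym_group d) \<sigma> \<inter>
         {p \<in> carrier (sym_group d). p (d - 1) = d - 1 \<and> p d = d} \<and>
       word_prod (sym_group d) w = transpose 1 2)"

end

theory Submission
  imports Defs
begin

text \<open>
  Everything is done with words, that is, with factorizations, modulo the Hurwitz moves.  A word with
  product one is central, and next to a word generating the group it may be conjugated by any
  element (\<open>central_word_conj\<close>).  Such central words are at hand: if $n = n_C$ is the order of $\sigma$,
  a word with enough letters in $C$ can be rewritten, by the pigeonhole principle, as a product of many
  blocks $x_g^n$, $g \in C$, and a remainder (\<open>extract_blocks\<close>).  A chain of subgroups of
  $\mathcal S_d$ is short, so only a few blocks are needed to generate $\mathcal S_d$ together with the
  remainder.  Therefore all blocks $x_g^n$ can be replaced by blocks $x_h^n$ with elements $h \in C$ of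
  our choice (\<open>blocks_free\<close>).

  Choose a word \<open>w\<close> of length $m_C$ in $C \cap \mathcal S_{d-2}$ with product $(1\,2)$; one exists because
  an odd permutation lies in no proper normal subgroup of $\mathcal S_{d-2}$ (\<open>transpose_in_normal_set\<close>).
  The conjugates of \<open>w\<close> are fake transpositions.  Some of the blocks are assembled to a central word
  \<open>R\<close> that generates $\mathcal S_d$, is equivalent to all its conjugates and contains fake transpositions.
  In the presence of \<open>R\<close>, a fake transposition depends only on the transposition under it
  (\<open>fake_cong\<close>).  The reason is that a fake transposition over $(a\,b)$ is conjugated by a disjoint $(i\,j)$
  when it passes a fake transposition over $(i\,j)$ and comes back; the latter can be chosen to be
  unaffected, because the letters of \<open>w\<close> fix $d-1$ and $d$.

  So, next to \<open>R\<close>, fake transpositions multiply like the letters $x_{(a\,b)}$, with the additional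
  relation that all squares are equal.  With that relation a product of transpositions is reduced to one
  in which at most one factor moves $d$, at most one other factor moves $d-1$, and so on.  Therefore it
  is determined by its length and its value (\<open>fakes_level_unique\<close>).

  Finally, other blocks provide $2(d-1)$ fake transpositions.  They can be rearranged such that a final
  segment has any prescribed product.  Pulling a letter through that segment changes it to any other
  member of its conjugacy class.  In this way the remainders of two words of the same type become equal
  (\<open>normalize_word\<close>).  What is left are two products of $2(d-1)$ fake transpositions next to \<open>R\<close>,
  with the same value, and these are equivalent.

  Altogether $d(d-1)m_C$ blocks of length $n_C$ are used; the bound follows from $n_C \le 2^{d-2}$.
\<close>


section \<open>Words modulo Hurwitz moves\<close>

sublocale group \<subseteq> full: factorization_semigroup G "carrier G"
  by unfold_locales auto

context group
begin

text \<open>The defining congruence lives on nonempty words.  Admitting the empty word, equivalent to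
  itself, allows a rewriting step to have an empty context on either side.\<close>

definition word_eq :: "'a list \<Rightarrow> 'a list \<Rightarrow> bool" (infix "\<doteq>" 50)
  where "u \<doteq> v \<longleftrightarrow> fact_cong G (carrier G) u v \<or> (u = v \<and> set u \<subseteq> carrier G)"

definition conj_word :: "'a \<Rightarrow> 'a list \<Rightarrow> 'a list"
  where "conj_word g = map (\<lambda>x. g \<otimes> x \<otimes> inv g)"

lemma word_prod_simps [simp]:
  "word_prod G [] = \<one>" "word_prod G (x # w) = x \<otimes> word_prod G w"
  by (simp_all add: word_prod_def)

lemmas word_prod_closed [simp, intro] = full.word_prod_closed
lemmas word_prod_append [simp] = full.word_prod_append

lemma conj_word_simps [simp]:
  "conj_word g [] = []"
  "conj_word g (x # w) = (g \<otimes> x \<otimes> inv g) # conj_word g w"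
  "conj_word g (u @ v) = conj_word g u @ conj_word g v"
  "length (conj_word g w) = length w"
  "conj_word g w = [] \<longleftrightarrow> w = []"
  by (simp_all add: conj_word_def)

lemma conj_word_closed [simp]:
  "g \<in> carrier G \<Longrightarrow> set w \<subseteq> carrier G \<Longrightarrow> set (conj_word g w) \<subseteq> carrier G"
  by (auto simp: conj_word_def)

lemma conj_mult:
  assumes "g \<in> carrier G" "h \<in> carrier G" "x \<in> carrier G"
  shows "g \<otimes> (h \<otimes> x \<otimes> inv h) \<otimes> inv g = (g \<otimes> h) \<otimes> x \<otimes> inv (g \<otimes> h)"
  using assms by (simp add: m_assoc inv_mult_group)

lemma conj_word_conj_word:
  "g \<in> carrier G \<Longrightarrow> h \<in> carrier G \<Longrightarrow> set w \<subseteq> carrier G \<Longrightarrow>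
    conj_word g (conj_word h w) = conj_word (g \<otimes> h) w"
  by (induction w) (auto simp: conj_mult)

lemma conj_word_one [simp]: "set w \<subseteq> carrier G \<Longrightarrow> conj_word \<one> w = w"
  by (induction w) auto

lemma conj_word_inv_cancel [simp]:
  assumes "g \<in> carrier G" "set w \<subseteq> carrier G"
  shows "conj_word (inv g) (conj_word g w) = w" "conj_word g (conj_word (inv g) w) = w"
  using assms by (simp_all add: conj_word_conj_word)

lemma conj_distrib:
  assumes "g \<in> carrier G" "x \<in> carrier G" "y \<in> carrier G"
  shows "(g \<otimes> x \<otimes> inv g) \<otimes> (g \<otimes> y \<otimes> inv g) = g \<otimes> (x \<otimes> y) \<otimes> inv g"
proof -
  have "(g \<otimes> x \<otimes> inv g) \<otimes> (g \<otimes> y \<otimes> inv g) = g \<otimes> x \<otimes> (inv g \<otimes> g) \<otimes> y \<otimes> inv g"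
    using assms by (simp only: m_assoc inv_closed m_closed)
  also have "\<dots> = g \<otimes> (x \<otimes> y) \<otimes> inv g" using assms by (simp add: m_assoc)
  finally show ?thesis .
qed

lemma word_prod_conj_word:
  "g \<in> carrier G \<Longrightarrow> set w \<subseteq> carrier G \<Longrightarrow>
    word_prod G (conj_word g w) = g \<otimes> word_prod G w \<otimes> inv g"
  by (induction w) (auto simp: conj_distrib)

lemma word_prod_conj_word_one:
  "g \<in> carrier G \<Longrightarrow> set w \<subseteq> carrier G \<Longrightarrow> word_prod G w = \<one> \<Longrightarrow>
    word_prod G (conj_word g w) = \<one>"
  by (simp add: word_prod_conj_word)

lemma word_prod_in_subgroup:
  "subgroup H G \<Longrightarrow> set v \<subseteq> H \<Longrightarrow> word_prod G v \<in> H"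
  by (induction v) (auto simp: subgroup.one_closed subgroup.m_closed)

lemma word_type_append [simp]: "word_type G (u @ v) = word_type G u + word_type G v"
  by (simp add: word_type_def)

lemma word_type_conj_word:
  "g \<in> carrier G \<Longrightarrow> set w \<subseteq> carrier G \<Longrightarrow> word_type G (conj_word g w) = word_type G w"
  by (induction w) (auto simp: word_type_def full.conj_class_conj full.conj_eq_one_iff)


lemma word_eq_refl [simp, intro]: "set u \<subseteq> carrier G \<Longrightarrow> u \<doteq> u"
  by (simp add: word_eq_def)

lemma word_eq_sym: "u \<doteq> v \<Longrightarrow> v \<doteq> u"
  by (auto simp: word_eq_def intro: fact_cong.sym)

lemma word_eq_trans [trans]: "u \<doteq> v \<Longrightarrow> v \<doteq> w \<Longrightarrow> u \<doteq> w"
  by (auto simp: word_eq_def intro: fact_cong.trans)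

lemma word_eq_closed:
  assumes "u \<doteq> v" shows "set u \<subseteq> carrier G" "set v \<subseteq> carrier G"
  using assms full.fact_cong_words by (auto simp: word_eq_def)

lemma word_eq_prod: "u \<doteq> v \<Longrightarrow> word_prod G u = word_prod G v"
  by (auto simp: word_eq_def full.word_prod_cong)

lemma word_eq_type: "u \<doteq> v \<Longrightarrow> word_type G u = word_type G v"
  by (auto simp: word_eq_def full.word_type_cong)

lemma word_eq_generate: "u \<doteq> v \<Longrightarrow> generate G (set u) = generate G (set v)"
  by (auto simp: word_eq_def full.generate_cong)

lemma fact_cong_imp_word_eq: "fact_cong G (carrier G) u v \<Longrightarrow> u \<doteq> v"
  by (simp add: word_eq_def)

lemma word_eq_imp_fact_cong: "u \<doteq> v \<Longrightarrow> u \<noteq> [] \<Longrightarrow> fact_cong G (carrier G) u v"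
  by (auto simp: word_eq_def intro: fact_cong.refl)

lemma word_eq_appendL:
  assumes "v \<doteq> v'" "set u \<subseteq> carrier G" shows "u @ v \<doteq> u @ v'"
proof (cases "u = []")
  case False
  with assms(2) have "fact_cong G (carrier G) u u" by (auto intro: fact_cong.refl)
  then show ?thesis using assms by (auto simp: word_eq_def intro: fact_cong.append)
qed (use assms in auto)

lemma word_eq_appendR:
  assumes "u \<doteq> u'" "set v \<subseteq> carrier G" shows "u @ v \<doteq> u' @ v"
proof (cases "v = []")
  case False
  with assms(2) have "fact_cong G (carrier G) v v" by (auto intro: fact_cong.refl)
  then show ?thesis using assms by (auto simp: word_eq_def intro: fact_cong.append)
qed (use assms in auto)

lemma word_eq_conj_word:
  assumes "u \<doteq> v" "g \<in> carrier G"
  shows "conj_word g u \<doteq> conj_word g v"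
proof -
  have "fact_cong G (carrier G) (conj_word g u) (conj_word g v)"
    if "fact_cong G (carrier G) u v" for u v
    using that
  proof (induction rule: fact_cong.induct)
    case (refl w)
    then show ?case using assms(2) by (intro fact_cong.refl) auto
  next
    case (append u u' v v')
    then show ?case by (simp add: fact_cong.append)
  next
    case (right a b)
    have "inv (g \<otimes> b \<otimes> inv g) \<otimes> (g \<otimes> a \<otimes> inv g) \<otimes> (g \<otimes> b \<otimes> inv g)
        = g \<otimes> (inv b \<otimes> a \<otimes> b) \<otimes> inv g"
      using right assms(2) conj_distrib[of g "inv b" a] conj_distrib[of g "inv b \<otimes> a" b]
      by (simp add: inv_mult_group m_assoc)
    moreover have "fact_cong G (carrier G) [g \<otimes> a \<otimes> inv g, g \<otimes> b \<otimes> inv g]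
       [g \<otimes> b \<otimes> inv g, inv (g \<otimes> b \<otimes> inv g) \<otimes> (g \<otimes> a \<otimes> inv g) \<otimes> (g \<otimes> b \<otimes> inv g)]"
      using right assms(2) by (intro fact_cong.right) auto
    ultimately show ?case by simp
  next
    case (left a b)
    have "(g \<otimes> a \<otimes> inv g) \<otimes> (g \<otimes> b \<otimes> inv g) \<otimes> inv (g \<otimes> a \<otimes> inv g)
        = g \<otimes> (a \<otimes> b \<otimes> inv a) \<otimes> inv g"
      using left assms(2) conj_distrib[of g a b] conj_distrib[of g "a \<otimes> b" "inv a"]
      by (simp add: inv_mult_group m_assoc)
    moreover have "fact_cong G (carrier G) [g \<otimes> a \<otimes> inv g, g \<otimes> b \<otimes> inv g]
       [(g \<otimes> a \<otimes> inv g) \<otimes> (g \<otimes> b \<otimes> inv g) \<otimes> inv (g \<otimes> a \<otimes> inv g), g \<otimes> a \<otimes> inv g]"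
      using left assms(2) by (intro fact_cong.left) auto
    ultimately show ?case by simp
  next
    case (unit a)
    then have "fact_cong G (carrier G) [g \<otimes> a \<otimes> inv g, \<one>] [g \<otimes> a \<otimes> inv g]"
      using assms(2) by (intro fact_cong.unit) auto
    then show ?case using assms(2) by simp
  next
    case (sym u v)
    then show ?case by (blast intro: fact_cong.sym)
  next
    case (trans u v w)
    then show ?case by (blast intro: fact_cong.trans)
  qed
  then show ?thesis using assms conj_word_closed[of g u] unfolding word_eq_def by blast
qed

text \<open>A letter travels to the left unchanged and conjugates what it passes.\<close>

lemma word_past_letter:
  assumes "set u \<subseteq> carrier G" "b \<in> carrier G"
  shows "u @ [b] \<doteq> [b] @ conj_word (inv b) u"
  using assms(1)
proof (induction u)
  case (Cons a u)
  then have c: "a \<in> carrier G" "set u \<subseteq> carrier G" by auto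
  have "[a] @ u @ [b] \<doteq> [a] @ [b] @ conj_word (inv b) u"
    using Cons c by (intro word_eq_appendL) auto
  also have "[a] @ [b] @ conj_word (inv b) u \<doteq> [b, inv b \<otimes> a \<otimes> b] @ conj_word (inv b) u"
    using word_eq_appendR[OF fact_cong_imp_word_eq[OF fact_cong.right[of a "carrier G" b G]]]
      c assms(2) by simp
  finally show ?case using assms(2) by (simp add: word_eq_def)
qed (use assms in auto)

lemma word_swap:
  assumes "set u \<subseteq> carrier G" "set v \<subseteq> carrier G"
  shows "u @ v \<doteq> v @ conj_word (inv (word_prod G v)) u"
  using assms
proof (induction v arbitrary: u)
  case (Cons b v)
  then have c: "b \<in> carrier G" "set v \<subseteq> carrier G" by auto
  have "u @ [b] @ v \<doteq> [b] @ conj_word (inv b) u @ v"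
    using word_eq_appendR[OF word_past_letter[of u b], of v] Cons.prems c by simp
  also have "[b] @ conj_word (inv b) u @ v \<doteq>
      [b] @ v @ conj_word (inv (word_prod G v)) (conj_word (inv b) u)"
    using Cons c by (intro word_eq_appendL Cons.IH) auto
  finally show ?case
    using Cons.prems c by (simp add: conj_word_conj_word inv_mult_group)
qed auto

lemma word_swap':
  assumes "set u \<subseteq> carrier G" "set v \<subseteq> carrier G"
  shows "u @ v \<doteq> conj_word (word_prod G u) v @ u"
proof -
  have "conj_word (word_prod G u) v @ u \<doteq>
      u @ conj_word (inv (word_prod G u)) (conj_word (word_prod G u) v)"
    using assms by (intro word_swap) auto
  then show ?thesis using assms by (auto intro: word_eq_sym)
qed

lemma word_central:
  assumes "set u \<subseteq> carrier G" "set v \<subseteq> carrier G" "word_prod G u = \<one>"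
  shows "u @ v \<doteq> v @ u"
  using word_swap'[OF assms(1,2)] assms by simp

text \<open>When the first letter of a word with product $p$ is moved to the end it becomes its conjugate by
  $p^{-1}$, and the rotated word again has product $p$; so this can be repeated letter by letter
  until the word has gone once around.\<close>

lemma word_rotate:
  assumes "set u \<subseteq> carrier G" "set v \<subseteq> carrier G"
  shows "u @ v \<doteq> v @ conj_word (inv (word_prod G (u @ v))) u"
  using assms
proof (induction u arbitrary: v)
  case (Cons a u)
  let ?p = "word_prod G (u @ v)" and ?q = "a \<otimes> word_prod G (u @ v)"
  have c: "a \<in> carrier G" "set u \<subseteq> carrier G" "?p \<in> carrier G"
    using Cons.prems by auto
  let ?a = "inv ?q \<otimes> a \<otimes> inv (inv ?q)"
  have "inv ?p \<otimes> inv a \<otimes> a = inv ?p" using c by (simp add: m_assoc)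
  then have "inv ?p \<otimes> a \<otimes> ?p = ?a"
    using c by (simp add: inv_mult_group m_assoc[symmetric])
  then have pass: "[a] @ (u @ v) \<doteq> (u @ v) @ [?a]"
    using word_swap[of "[a]" "u @ v"] c Cons.prems by simp
  have prod: "word_prod G (u @ v @ [?a]) = ?q"
    using word_eq_prod[OF pass] c Cons.prems by simp
  note pass
  also have "(u @ v) @ [?a] \<doteq> (v @ [?a]) @ conj_word (inv (word_prod G (u @ v @ [?a]))) u"
    using Cons.IH[of "v @ [?a]"] c Cons.prems by simp
  also note prod
  finally show ?case using c Cons.prems by simp
qed auto

text \<open>Consequently a word cannot be told from its conjugate by its own product.\<close>

lemma word_eq_conj_prod:
  assumes "set u \<subseteq> carrier G"
  shows "u \<doteq> conj_word (word_prod G u) u"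
proof -
  have "u \<doteq> conj_word (inv (word_prod G u)) u" using word_rotate[of u "[]"] assms by simp
  from word_eq_conj_word[OF this, of "word_prod G u"] show ?thesis
    using assms by (auto intro: word_eq_sym)
qed

text \<open>A word \<open>u\<close> with product one commutes with everything, so it can be carried to a letter \<open>a\<close> of
  \<open>v\<close>, pulled through \<open>a\<close> by the Hurwitz move, which conjugates it by \<open>a\<close>, and carried back.\<close>

lemma central_word_conj:
  assumes "set u \<subseteq> carrier G" "word_prod G u = \<one>" "set v \<subseteq> carrier G"
    and "g \<in> generate G (set v)"
  shows "u @ v \<doteq> conj_word g u @ v"
proof -
  have letter: "u @ v \<doteq> conj_word a u @ v \<and> u @ v \<doteq> conj_word (inv a) u @ v"
    if a: "a \<in> set v" and u: "set u \<subseteq> carrier G" "word_prod G u = \<one>" for a u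
  proof -
    obtain v1 v2 where v: "v = v1 @ [a] @ v2" using split_list[OF a] by auto
    have c: "a \<in> carrier G" "set v1 \<subseteq> carrier G" "set v2 \<subseteq> carrier G"
      using assms(3) v by auto
    have one: "word_prod G (conj_word g u) = \<one>"
      if "g \<in> carrier G" "set u \<subseteq> carrier G" "word_prod G u = \<one>" for g u
      using that by (rule word_prod_conj_word_one)
    have inv: "u @ v \<doteq> conj_word (inv a) u @ v"
      if u: "set u \<subseteq> carrier G" "word_prod G u = \<one>" for u
    proof -
      have "u @ v1 @ [a] @ v2 \<doteq> v1 @ u @ [a] @ v2"
        using word_eq_appendR[OF word_central[of u v1], of "[a] @ v2"] u c by simp
      also have "v1 @ u @ [a] @ v2 \<doteq> v1 @ [a] @ conj_word (inv a) u @ v2"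
        using word_eq_appendL[OF word_eq_appendR[OF word_past_letter[of u a]], of v2 v1] u c by simp
      also have "v1 @ [a] @ conj_word (inv a) u @ v2 \<doteq> conj_word (inv a) u @ v1 @ [a] @ v2"
        using word_eq_appendR[OF word_eq_sym[OF word_central[of "conj_word (inv a) u" "v1 @ [a]"]], of v2]
          u c by (simp add: one)
      finally show ?thesis using v by simp
    qed
    have "conj_word a u @ v \<doteq> conj_word (inv a) (conj_word a u) @ v"
      using u c by (intro inv) (auto simp: one)
    then show ?thesis using u c inv[of u] by (auto intro: word_eq_sym)
  qed
  have sub: "h \<in> carrier G" if "h \<in> generate G (set v)" for h
    using that assms(3) generate_in_carrier by blast
  from assms(4,1,2) show ?thesis
  proof (induction arbitrary: u rule: generate.induct)
    case one
    then show ?case using assms(3) by auto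
  next
    case (eng h1 h2)
    note c = sub[OF eng.hyps(1)] sub[OF eng.hyps(2)]
    have "u @ v \<doteq> conj_word h2 u @ v" using eng by blast
    also have "\<dots> \<doteq> conj_word h1 (conj_word h2 u) @ v"
      using eng c by (intro eng.IH) (auto simp: word_prod_conj_word_one)
    finally show ?case using eng.prems c by (simp add: conj_word_conj_word)
  qed (use letter in auto)
qed

text \<open>Two copies of a generating word with product one serve each other: each is conjugated by the
  letters of the other one.\<close>

lemma double_word_conj:
  assumes "set u \<subseteq> carrier G" "word_prod G u = \<one>" "generate G (set u) = carrier G" "g \<in> carrier G"
  shows "u @ u \<doteq> conj_word g (u @ u)"
proof -
  have one: "u @ u \<doteq> conj_word h u @ u" if "h \<in> carrier G" for h
    using assms that by (intro central_word_conj) auto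
  have c: "set (conj_word g u) \<subseteq> carrier G" using assms by simp
  note one[OF assms(4)]
  also have "conj_word g u @ u \<doteq> u @ conj_word g u"
    using c assms by (intro word_eq_sym[OF word_central]) auto
  also have "u @ conj_word g u \<doteq> conj_word g u @ conj_word g u"
    using word_eq_sym[OF word_eq_conj_word[OF one[of "inv g"] assms(4)]]
      word_eq_conj_word[OF one[of "inv g"] assms(4)] assms by simp
  finally show ?thesis by simp
qed

text \<open>The relation absorbing $x_1$ needs a letter to its left.\<close>

lemma word_delete_ones:
  assumes "set u \<subseteq> carrier G" "set v \<subseteq> carrier G" "u \<noteq> []"
  shows "u @ v \<doteq> u @ filter (\<lambda>x. x \<noteq> \<one>) v"
  using assms
proof (induction v arbitrary: u)
  case (Cons a v)
  show ?case
  proof (cases "a = \<one>")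
    case True
    obtain u' b where u: "u = u' @ [b]" using Cons.prems(3) by (cases u rule: rev_cases) auto
    have "[b, \<one>] \<doteq> [b]"
      using Cons.prems u by (intro fact_cong_imp_word_eq fact_cong.unit) auto
    from word_eq_appendL[OF word_eq_appendR[OF this]]
    have "u' @ [b, \<one>] @ v \<doteq> u @ v"
      using Cons.prems u by simp
    also have "u @ v \<doteq> u @ filter (\<lambda>x. x \<noteq> \<one>) v" using Cons by auto
    finally show ?thesis using u True by simp
  next
    case False
    then show ?thesis using Cons.IH[of "u @ [a]"] Cons.prems by simp
  qed
qed auto

lemma word_pull:
  assumes "set u \<subseteq> carrier G" "z \<in> carrier G" "set v \<subseteq> carrier G"
  shows "u @ [z] @ v \<doteq> [z] @ conj_word (inv z) u @ v"
  using word_eq_appendR[OF word_past_letter[OF assms(1,2)] assms(3)] by simp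


section \<open>Blocks\<close>

definition torsion :: "nat \<Rightarrow> 'a set"
  where "torsion n = {x \<in> carrier G. x [^] n = \<one>}"

text \<open>For letters \<open>h\<close> with $h^n = 1$ each block $x_h^n$ has product one.  Hence blocks are central, and
  in the presence of a generating word they can be conjugated at will.\<close>

definition blocks :: "nat \<Rightarrow> 'a list \<Rightarrow> 'a list"
  where "blocks n hs = concat (map (replicate n) hs)"

lemma blocks_simps [simp]:
  "blocks n [] = []"
  "blocks n (h # hs) = replicate n h @ blocks n hs"
  "blocks n (hs @ ks) = blocks n hs @ blocks n ks"
  by (simp_all add: blocks_def)

lemma set_blocks [simp]: "n > 0 \<Longrightarrow> set (blocks n hs) = set hs"
  by (induction hs) auto

lemma set_blocks_subset: "set (blocks n hs) \<subseteq> set hs"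
  by (induction hs) auto

lemma blocks_closed [simp]: "set hs \<subseteq> carrier G \<Longrightarrow> set (blocks n hs) \<subseteq> carrier G"
  using set_blocks_subset by blast

lemma replicate_closed [simp]: "x \<in> carrier G \<Longrightarrow> set (replicate n x) \<subseteq> carrier G"
  by auto

lemma torsion_closed: "x \<in> torsion n \<Longrightarrow> x \<in> carrier G"
  by (simp add: torsion_def)

lemma word_prod_replicate: "x \<in> carrier G \<Longrightarrow> word_prod G (replicate k x) = x [^] k"
  by (induction k) (auto simp: nat_pow_Suc2[symmetric] simp del: nat_pow_Suc)

lemma conj_word_replicate: "conj_word g (replicate k x) = replicate k (g \<otimes> x \<otimes> inv g)"
  by (simp add: conj_word_def)

lemma torsion_conj:
  assumes "x \<in> torsion n" "g \<in> carrier G"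
  shows "g \<otimes> x \<otimes> inv g \<in> torsion n"
  using assms word_prod_conj_word[of g "replicate n x"]
  by (simp add: torsion_def word_prod_replicate conj_word_replicate)

lemma word_prod_blocks: "set hs \<subseteq> torsion n \<Longrightarrow> word_prod G (blocks n hs) = \<one>"
proof (induction hs)
  case (Cons h hs)
  then have "set hs \<subseteq> carrier G" by (auto simp: torsion_def)
  with Cons show ?case by (auto simp: torsion_def word_prod_replicate)
qed auto

lemma blocks_perm:
  assumes "mset hs = mset ks" "set hs \<subseteq> torsion n"
  shows "blocks n hs \<doteq> blocks n ks"
  using assms
proof (induction hs arbitrary: ks)
  case (Cons h hs)
  have "h \<in> set ks" using Cons.prems(1) by (metis list.set_intros(1) set_mset_mset)
  then obtain a b where ks: "ks = a @ h # b" by (meson split_list)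
  have c: "h \<in> torsion n" "set hs \<subseteq> torsion n" "set ks \<subseteq> torsion n"
    using mset_eq_setD[OF Cons.prems(1)] Cons.prems(2) by auto
  then have c': "h \<in> carrier G" "set hs \<subseteq> carrier G" "set a \<subseteq> carrier G" "set b \<subseteq> carrier G"
    using ks by (auto simp: torsion_def)
  have "mset hs = mset (a @ b)" using Cons.prems(1) ks by simp
  then have "blocks n hs \<doteq> blocks n (a @ b)" using Cons.IH c by blast
  then have "replicate n h @ blocks n hs \<doteq> replicate n h @ blocks n (a @ b)"
    using c' by (intro word_eq_appendL) auto
  also have "replicate n h @ blocks n (a @ b) \<doteq> blocks n a @ replicate n h @ blocks n b"
    using word_eq_appendR[OF word_central[of "replicate n h" "blocks n a"], of "blocks n b"] c c'
    by (simp add: word_prod_replicate torsion_def)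
  finally show ?case by (simp add: ks)
qed auto

text \<open>One letter of each block can be brought to the front: what remains of the first block is moved
  behind the later blocks, which are central.\<close>

lemma blocks_split:
  assumes "n > 0" "set hs \<subseteq> torsion n"
  shows "\<exists>rest. set rest \<subseteq> carrier G \<and> blocks n hs \<doteq> hs @ rest"
  using assms(2)
proof (induction hs)
  case Nil
  then show ?case by (intro exI[of _ "[]"]) auto
next
  case (Cons h hs)
  then obtain rest where rest: "set rest \<subseteq> carrier G" "blocks n hs \<doteq> hs @ rest" by auto
  have c: "h \<in> carrier G" "set hs \<subseteq> carrier G" using Cons.prems by (auto simp: torsion_def)
  let ?r = "replicate (n - 1) h"
  have "?r @ blocks n hs \<doteq> blocks n hs @ ?r"
    using c Cons.prems by (intro word_eq_sym[OF word_central]) (auto simp: word_prod_blocks)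
  also have "blocks n hs @ ?r \<doteq> hs @ rest @ ?r"
    using word_eq_appendR[OF rest(2), of ?r] c by simp
  finally have "[h] @ ?r @ blocks n hs \<doteq> [h] @ hs @ rest @ ?r"
    using c by (intro word_eq_appendL) auto
  moreover have "[h] @ ?r = replicate n h"
    using assms(1) by (cases n) auto
  ultimately have "blocks n (h # hs) \<doteq> (h # hs) @ rest @ ?r"
    by (metis append.assoc append_Cons append_Nil blocks_simps(2))
  moreover have "set (rest @ ?r) \<subseteq> carrier G" using rest c by auto
  ultimately show ?case by blast
qed


lemma conj_class_self: "x \<in> carrier G \<Longrightarrow> x \<in> conj_class G x"
  by (auto simp: conj_class_def intro!: exI[of _ \<one>])

lemma conj_class_eq_iff:
  assumes "x \<in> carrier G" "y \<in> carrier G"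
  shows "conj_class G x = conj_class G y \<longleftrightarrow> x \<in> conj_class G y"
proof
  assume "x \<in> conj_class G y"
  then obtain h where "h \<in> carrier G" "x = h \<otimes> y \<otimes> inv h" by (auto simp: conj_class_def)
  then show "conj_class G x = conj_class G y" using assms full.conj_class_conj by simp
qed (use conj_class_self[OF assms(1)] in simp)

lemma conj_class_closed: "x \<in> carrier G \<Longrightarrow> conj_class G x \<subseteq> carrier G"
  by (auto simp: conj_class_def)

lemma conj_class_torsion: "x \<in> torsion n \<Longrightarrow> conj_class G x \<subseteq> torsion n"
  using torsion_conj by (auto simp: conj_class_def)

lemma conj_class_closed_conj:
  assumes "x \<in> carrier G" "y \<in> conj_class G x" "g \<in> carrier G"
  shows "g \<otimes> y \<otimes> inv g \<in> conj_class G x"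
  using assms conj_class_closed full.conj_class_conj conj_class_eq_iff
  by (metis (no_types, lifting) in_mono inv_closed m_closed)

lemma conj_word_conj_class:
  "x \<in> carrier G \<Longrightarrow> set w \<subseteq> conj_class G x \<Longrightarrow> g \<in> carrier G \<Longrightarrow>
    set (conj_word g w) \<subseteq> conj_class G x"
  using conj_class_closed_conj by (auto simp: conj_word_def)

lemma conj_class_transitive:
  assumes "x \<in> carrier G" "y \<in> conj_class G x" "z \<in> conj_class G x"
  shows "\<exists>g\<in>carrier G. g \<otimes> y \<otimes> inv g = z"
proof -
  have "z \<in> conj_class G y"
    using assms conj_class_closed conj_class_eq_iff by (metis subsetD)
  then show ?thesis by (auto simp: conj_class_def)
qed

lemma count_word_type:
  assumes "x \<in> carrier G" "x \<noteq> \<one>" "set w \<subseteq> carrier G"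
  shows "count (word_type G w) (conj_class G x) = length (filter (\<lambda>y. y \<in> conj_class G x) w)"
proof -
  have "y \<noteq> \<one>" if "y \<in> conj_class G x" for y
    using that assms full.conj_eq_one_iff by (auto simp: conj_class_def)
  then show ?thesis
    using assms(3) conj_class_eq_iff[OF _ assms(1)]
    by (induction w) (auto simp: word_type_def)
qed

text \<open>Moving the leftmost occurrence of \<open>g\<close> to the front conjugates only the letters before it, so the
  later occurrences of \<open>g\<close> survive and can follow.\<close>

lemma gather_letter:
  assumes "set w \<subseteq> carrier G" "k \<le> count_list w g"
  shows "\<exists>w'. set w' \<subseteq> carrier G \<and> w \<doteq> replicate k g @ w'"
  using assms
proof (induction k arbitrary: w)
  case 0
  then show ?case by auto
next
  case (Suc k)
  have "g \<in> set w" using Suc.prems(2) count_notin by fastforce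
  then obtain a b where w: "w = a @ g # b" "g \<notin> set a" by (meson split_list_first)
  have c: "g \<in> carrier G" "set a \<subseteq> carrier G" "set b \<subseteq> carrier G" using Suc.prems w by auto
  let ?v = "conj_word (inv g) a @ b"
  have "k \<le> count_list ?v g" using Suc.prems(2) w by (simp add: count_list_append)
  then obtain w' where w': "set w' \<subseteq> carrier G" "?v \<doteq> replicate k g @ w'"
    using Suc.IH[of ?v] c by auto
  have "w \<doteq> [g] @ ?v" using word_pull[of a g b] c w by simp
  also have "\<dots> \<doteq> [g] @ replicate k g @ w'" using c w' by (intro word_eq_appendL) auto
  finally show ?case using w' by auto
qed

text \<open>By the pigeonhole principle some element of the class occurs at least \<open>n\<close> times.\<close>

lemma extract_block:
  assumes "finite (conj_class G x)" "x \<in> carrier G" "x \<noteq> \<one>" "set w \<subseteq> carrier G"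
    and "(n - 1) * card (conj_class G x) < count (word_type G w) (conj_class G x)"
  shows "\<exists>g\<in>conj_class G x. \<exists>w'. set w' \<subseteq> carrier G \<and> w \<doteq> replicate n g @ w'"
proof -
  let ?C = "conj_class G x"
  have "(\<Sum>g\<in>?C. count_list w g) = length (filter (\<lambda>y. y \<in> ?C) w)"
  proof (induction w)
    case (Cons a w)
    have "(\<Sum>g\<in>?C. count_list (a # w) g) = (\<Sum>g\<in>?C. count_list w g + (if a = g then 1 else 0))"
      by (intro sum.cong) auto
    then show ?case using Cons assms(1) by (simp add: sum.distrib)
  qed auto
  then have "(n - 1) * card ?C < (\<Sum>g\<in>?C. count_list w g)"
    using assms by (simp add: count_word_type)
  moreover have "(\<Sum>g\<in>?C. count_list w g) \<le> card ?C * (n - 1)"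
    if "\<And>g. g \<in> ?C \<Longrightarrow> count_list w g \<le> n - 1"
    using sum_bounded_above[of ?C "count_list w" "n - 1"] that by simp
  ultimately obtain g where "g \<in> ?C" "n - 1 < count_list w g"
    by (metis mult.commute not_le)
  then have "g \<in> ?C" "n \<le> count_list w g" by simp_all
  then show ?thesis using gather_letter[OF assms(4)] by blast
qed

lemma extract_blocks:
  assumes "finite (conj_class G x)" "x \<in> carrier G" "x \<noteq> \<one>" "n > 0"
    and "set w \<subseteq> carrier G"
    and "K * n + n * card (conj_class G x) \<le> count (word_type G w) (conj_class G x)"
  shows "\<exists>gs w'. length gs = K \<and> set gs \<subseteq> conj_class G x \<and> set w' \<subseteq> carrier G \<and>
    w \<doteq> blocks n gs @ w'"
  using assms(5,6)
proof (induction K arbitrary: w)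
  case 0
  then show ?case by auto
next
  case (Suc K)
  let ?C = "conj_class G x"
  have "(n - 1) * card ?C < count (word_type G w) ?C"
    using Suc.prems assms(4) by (simp add: diff_mult_distrib)
  then obtain g w' where g: "g \<in> ?C" "set w' \<subseteq> carrier G" "w \<doteq> replicate n g @ w'"
    using extract_block[of x w n] assms Suc.prems by blast
  have gc: "g \<in> carrier G" using g conj_class_closed assms(2) by blast
  have "count (word_type G w) ?C \<le> n + count (word_type G w') ?C"
    using word_eq_type[OF g(3)] g gc assms by (simp add: count_word_type del: filter_replicate)
  then have "K * n + n * card ?C \<le> count (word_type G w') ?C"
    using Suc.prems by simp
  then obtain gs w'' where IH: "length gs = K" "set gs \<subseteq> ?C" "set w'' \<subseteq> carrier G"
      "w' \<doteq> blocks n gs @ w''"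
    using Suc.IH[OF g(2)] by blast
  note g(3)
  also have "replicate n g @ w' \<doteq> replicate n g @ blocks n gs @ w''"
    using IH gc by (intro word_eq_appendL) auto
  finally have "w \<doteq> blocks n (g # gs) @ w''" by simp
  then show ?case using IH g by (intro exI[of _ "g # gs"] exI[of _ w'']) auto
qed


text \<open>Every strict step in a chain of subgroups at least doubles the order.\<close>

lemma small_generating_subset:
  assumes "finite (carrier G)" "finite A" "A \<subseteq> carrier G" "B \<subseteq> carrier G"
  shows "\<exists>A'\<subseteq>A. generate G (A' \<union> B) = generate G (A \<union> B) \<and>
    2 ^ card A' \<le> card (generate G (A' \<union> B))"
  using assms(2,3)
proof (induction A rule: finite_induct)
  case empty
  have "finite (generate G B)"
    by (rule finite_subset[OF generate_incl[OF assms(4)] assms(1)])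
  then have "card (generate G B) \<ge> 1"
    using generate.one[of G B] by (auto simp: Suc_le_eq card_gt_0_iff)
  then show ?case by auto
next
  case (insert a A)
  then obtain A' where A': "A' \<subseteq> A" "generate G (A' \<union> B) = generate G (A \<union> B)"
    "2 ^ card A' \<le> card (generate G (A' \<union> B))" by auto
  let ?H = "generate G (A' \<union> B)"
  have a: "a \<in> carrier G" and AB: "A' \<union> B \<subseteq> carrier G" "A \<union> B \<subseteq> carrier G"
    using insert.prems A'(1) assms(4) by auto
  have H: "subgroup ?H G" using AB by (intro generate_is_subgroup)
  have inc: "Z \<subseteq> generate G Z" for Z by (auto intro: generate.incl)
  have mono: "Z \<subseteq> Y \<Longrightarrow> generate G Z \<subseteq> generate G Y" for Z Y by (rule mono_generate)
  show ?case
  proof (cases "a \<in> ?H")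
    case True
    have "generate G (A' \<union> B) = generate G (insert a A \<union> B)"
      using AB a True A'(1) inc[of "A \<union> B"] mono[of "A' \<union> B" "insert a A \<union> B"]
        inc[of "insert a A \<union> B"] A'(2)
      by (intro full.generate_eqI) auto
    then show ?thesis using A' by blast
  next
    case False
    let ?H2 = "generate G (insert a A' \<union> B)"
    have eq: "?H2 = generate G (insert a A \<union> B)"
    proof (rule full.generate_eqI)
      show "insert a A' \<union> B \<subseteq> generate G (insert a A \<union> B)"
        using inc[of "insert a A \<union> B"] A'(1) by auto
      show "insert a A \<union> B \<subseteq> ?H2"
        using inc[of "A \<union> B"] A'(2) mono[of "A' \<union> B" "insert a A' \<union> B"] inc[of "insert a A' \<union> B"]
        by auto
    qed (use AB a in auto)
    have fin: "finite ?H2"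
      using AB a by (intro finite_subset[OF generate_incl assms(1)]) auto
    have H2: "subgroup ?H2 G" using AB a by (intro generate_is_subgroup) auto
    have sub: "?H \<subseteq> ?H2" "(\<lambda>h. a \<otimes> h) ` ?H \<subseteq> ?H2"
    proof -
      show "?H \<subseteq> ?H2" by (rule mono) auto
      moreover have "a \<in> ?H2" by (auto intro: generate.incl)
      ultimately show "(\<lambda>h. a \<otimes> h) ` ?H \<subseteq> ?H2"
        using subgroup.m_closed[OF H2] by blast
    qed
    have disj: "?H \<inter> (\<lambda>h. a \<otimes> h) ` ?H = {}"
    proof (rule ccontr)
      assume "?H \<inter> (\<lambda>h. a \<otimes> h) ` ?H \<noteq> {}"
      then obtain h where h: "h \<in> ?H" "a \<otimes> h \<in> ?H" by auto
      then have "(a \<otimes> h) \<otimes> inv h \<in> ?H"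
        using subgroup.m_closed[OF H] subgroup.m_inv_closed[OF H] by blast
      moreover have "(a \<otimes> h) \<otimes> inv h = a"
        using a h subgroup.subset[OF H] by (simp add: m_assoc subset_iff)
      ultimately show False using False by simp
    qed
    have "inj_on (\<lambda>h. a \<otimes> h) ?H"
      using a subgroup.subset[OF H] by (intro inj_onI) (auto simp: subset_iff)
    then have "card ((\<lambda>h. a \<otimes> h) ` ?H) = card ?H" by (rule card_image)
    then have "2 * card ?H = card (?H \<union> (\<lambda>h. a \<otimes> h) ` ?H)"
      using disj fin sub card_Un_disjoint[of ?H "(\<lambda>h. a \<otimes> h) ` ?H"]
      by (simp add: finite_subset)
    also have "\<dots> \<le> card ?H2" using fin sub by (intro card_mono) auto
    finally have "2 * card ?H \<le> card ?H2" .
    moreover have "card (insert a A') = Suc (card A')"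
      using A'(1) insert.hyps finite_subset[OF A'(1)] by (intro card_insert_disjoint) auto
    ultimately have "2 ^ card (insert a A') \<le> card ?H2" using A'(3) by simp
    then show ?thesis using eq A'(1)
      by (intro exI[of _ "insert a A'"]) auto
  qed
qed

lemma blocks_replace:
  assumes "x \<in> torsion n" "n > 0" "length gs = length hs"
    and "set gs \<subseteq> conj_class G x" "set hs \<subseteq> conj_class G x"
    and "set v \<subseteq> carrier G" "generate G (set v) = carrier G"
  shows "blocks n gs @ v \<doteq> blocks n hs @ v"
  using assms(3-5)
proof (induction gs hs rule: list_induct2)
  case Nil
  then show ?case using assms by auto
next
  case (Cons g gs h hs)
  have x: "x \<in> carrier G" using assms(1) torsion_closed by simp
  have tor: "conj_class G x \<subseteq> torsion n" using assms(1) by (rule conj_class_torsion)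
  then have c: "g \<in> torsion n" "g \<in> carrier G" "h \<in> carrier G" "set gs \<subseteq> carrier G"
    using Cons.prems conj_class_closed[OF x] by auto
  obtain k where k: "k \<in> carrier G" "k \<otimes> g \<otimes> inv k = h"
    using conj_class_transitive[OF x, of g h] Cons.prems by auto
  have "generate G (set (blocks n gs @ v)) = carrier G"
    using mono_generate[of "set v" "set (blocks n gs @ v)"] assms(6,7) c
      generate_incl[of "set (blocks n gs @ v)"] by auto
  then have "replicate n g @ blocks n gs @ v \<doteq> conj_word k (replicate n g) @ blocks n gs @ v"
    using c k assms(6) by (intro central_word_conj) (auto simp: word_prod_replicate torsion_def)
  also have "\<dots> = replicate n h @ blocks n gs @ v" by (simp add: conj_word_replicate k)
  also have "\<dots> \<doteq> replicate n h @ blocks n hs @ v"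
    using c Cons by (intro word_eq_appendL) auto
  finally show ?case by simp
qed

text \<open>Boundedly many of the blocks suffice to generate the group together with \<open>q\<close>.  All others may then be
  replaced, and they are replaced by blocks that begin with \<open>hs\<close>.  As \<open>hs\<close> generates the group by
  itself, the blocks that were held back become replaceable as well.\<close>

lemma blocks_free:
  assumes x: "x \<in> torsion n" "n > 0" and fin: "finite (carrier G)"
    and gs: "set gs \<subseteq> conj_class G x" and q: "set q \<subseteq> carrier G"
    and gen: "generate G (set gs \<union> set q) = carrier G"
    and hs: "set (hs @ ks) \<subseteq> conj_class G x" "generate G (set hs) = carrier G"
    and len: "length gs = length (hs @ ks)"
    and room: "\<And>r. 2 ^ r \<le> order G \<Longrightarrow> r + length hs \<le> length gs"
  shows "blocks n gs @ q \<doteq> blocks n (hs @ ks) @ q"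
proof -
  have xc: "x \<in> carrier G" using x torsion_closed by simp
  have tor: "conj_class G x \<subseteq> torsion n" "conj_class G x \<subseteq> carrier G"
    using x conj_class_torsion conj_class_closed[OF xc] by auto
  obtain A where A: "A \<subseteq> set gs" "generate G (A \<union> set q) = generate G (set gs \<union> set q)"
      "2 ^ card A \<le> card (generate G (A \<union> set q))"
    using small_generating_subset[OF fin List.finite_set subset_trans[OF gs tor(2)] q] by blast
  obtain as where as: "set as = A" "distinct as"
    using finite_distinct_list[OF finite_subset[OF A(1)]] by blast
  have "mset as \<subseteq># mset gs"
  proof (rule mset_subset_eqI)
    fix a
    show "count (mset as) a \<le> count (mset gs) a"
      using as A(1) count_mset_gt_0[of a gs] distinct_count_atmost_1[of as] by (auto split: if_splits)
  qed
  then have "mset gs = (mset gs - mset as) + mset as" by simp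
  moreover obtain bs where "mset bs = mset gs - mset as" using ex_mset by blast
  ultimately have bs: "mset gs = mset (bs @ as)" by simp
  have "card A \<le> length gs - length hs" "length hs + card A \<le> length gs"
    using room[of "card A"] A gen by (auto simp: order_def)
  moreover have "length gs = length bs + length as"
    using mset_eq_length[OF bs] by simp
  moreover have "length as = card A" using as distinct_card[of as] by simp
  ultimately have lb: "length hs \<le> length bs" by simp
  \<comment> \<open>The blocks \<open>as\<close> are held back; \<open>bs\<close> is turned into \<open>h1\<close>, which contains \<open>hs\<close>, and then \<open>as\<close>
    into \<open>h2\<close>.\<close>
  define h1 where "h1 = take (length bs) (hs @ ks)"
  define h2 where "h2 = drop (length bs) (hs @ ks)"
  have hk: "hs @ ks = h1 @ h2" unfolding h1_def h2_def by (rule append_take_drop_id[symmetric])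
  have l: "length bs = length h1" "length as = length h2"
    using len \<open>length gs = length bs + length as\<close> by (auto simp: h1_def h2_def)
  have sub: "set h1 \<subseteq> conj_class G x" "set h2 \<subseteq> conj_class G x"
    using hs(1) unfolding hk by auto
  have sub': "set bs \<subseteq> conj_class G x" "set as \<subseteq> conj_class G x"
    using gs mset_eq_setD[OF bs] by auto
  have genh1: "generate G (set (blocks n h1 @ q)) = carrier G"
  proof -
    have "set hs \<subseteq> set h1" using lb by (auto simp: h1_def)
    then show ?thesis
      using mono_generate[of "set hs" "set (blocks n h1 @ q)"] hs(2) x(2) sub tor q
        generate_incl[of "set (blocks n h1 @ q)"] subset_trans[OF sub(1) tor(2)] by auto
  qed
  have genas: "generate G (set (blocks n as @ q)) = carrier G"
    using A(2) as gen x(2) by simp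
  have "blocks n gs \<doteq> blocks n (bs @ as)"
    using bs gs tor by (intro blocks_perm) auto
  then have "blocks n gs @ q \<doteq> blocks n bs @ blocks n as @ q"
    using word_eq_appendR[of "blocks n gs" _ q] q by fastforce
  also have "\<dots> \<doteq> blocks n h1 @ blocks n as @ q"
    using x l sub sub' tor q genas by (intro blocks_replace) auto
  also have "\<dots> \<doteq> blocks n as @ blocks n h1 @ q"
    using word_eq_appendR[OF word_central[of "blocks n h1" "blocks n as"] q] sub sub' tor
      word_prod_blocks[of h1 n] by auto
  also have "\<dots> \<doteq> blocks n h2 @ blocks n h1 @ q"
    using x l sub sub' tor q genh1 by (intro blocks_replace) auto
  also have "\<dots> \<doteq> blocks n h1 @ blocks n h2 @ q"
    using word_eq_appendR[OF word_central[of "blocks n h2" "blocks n h1"] q] sub tor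
      word_prod_blocks[of h2 n] by auto
  finally show ?thesis unfolding hk by simp
qed

end


section \<open>Permutations and transpositions\<close>

lemma permutes_extension:
  assumes "finite S" "A \<subseteq> S" "inj_on f A" "f ` A \<subseteq> S"
  shows "\<exists>p. p permutes S \<and> (\<forall>x\<in>A. p x = f x)"
proof -
  have fin: "finite (S - A)" "finite (S - f ` A)" "finite A"
    using assms(1,2) by (auto intro: finite_subset)
  have "card (S - A) = card (S - f ` A)"
    using assms fin by (simp add: card_Diff_subset card_image)
  then obtain b where b: "bij_betw b (S - A) (S - f ` A)"
    using finite_same_card_bij[OF fin(1,2)] by blast
  define p where "p x = (if x \<in> A then f x else if x \<in> S then b x else x)" for x
  have "bij_betw p A (f ` A)"
    using assms(3) by (simp add: bij_betw_def inj_on_def p_def)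
  moreover have "bij_betw p (S - A) (S - f ` A)"
    using b by (subst bij_betw_cong[where g = b]) (auto simp: p_def)
  ultimately have "bij_betw p (A \<union> (S - A)) (f ` A \<union> (S - f ` A))"
    by (rule bij_betw_combine) auto
  then have "bij_betw p S S" using assms(2,4) by (simp add: Un_absorb1)
  then have "p permutes S"
    by (rule bij_imp_permutes) (use assms(2) in \<open>auto simp: p_def\<close>)
  then show ?thesis by (auto simp: p_def)
qed

lemma comp_transpose:
  assumes "inj g" shows "g \<circ> transpose a b = transpose (g a) (g b) \<circ> g"
  using assms by (auto simp: fun_eq_iff transpose_def dest: injD)

lemma transpose_eqD:
  assumes "transpose a b = transpose c e" "a \<noteq> b"
  shows "a = c \<and> b = e \<or> a = e \<and> b = c"
  using assms by (metis transpose_apply_first transpose_apply_other)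

lemma transpose_in_sym_group:
  "i \<in> {1..d} \<Longrightarrow> j \<in> {1..d} \<Longrightarrow> transpose i j \<in> carrier (sym_group d)"
  by (simp add: sym_group_carrier permutes_swap_id)

lemma sym_group_conj_transpose:
  assumes "g \<in> carrier (sym_group d)"
  shows "g \<otimes>\<^bsub>sym_group d\<^esub> transpose i j \<otimes>\<^bsub>sym_group d\<^esub> inv\<^bsub>sym_group d\<^esub> g = transpose (g i) (g j)"
proof -
  have "g permutes {1..d}" using assms sym_group_carrier by simp
  then have "inj g" "g \<circ> inv' g = id" using permutes_inj permutes_inv_o(1) by auto
  then show ?thesis
    using assms by (simp add: sym_group_mult comp_transpose comp_assoc)
qed


text \<open>Let \<open>l\<close> be the length of the cycle through a moved point.  Then $p^l$ moves at least \<open>l\<close> points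
  fewer than \<open>p\<close>, and $l \le 2^l$.\<close>

lemma permutation_power_bound:
  assumes "p permutes S" "finite S"
  shows "\<exists>N>0. N \<le> 2 ^ card {x. p x \<noteq> x} \<and> p ^^ N = id"
  using assms(1)
proof (induction "card {x. p x \<noteq> x}" arbitrary: p rule: less_induct)
  case less
  have perm: "permutation p" using less.prems assms(2) by (auto simp: permutation_permutes)
  have "{x. p x \<noteq> x} \<subseteq> S" using less.prems by (auto simp: permutes_def)
  then have fin: "finite {x. p x \<noteq> x}" using assms(2) finite_subset by blast
  show ?case
  proof (cases "{x. p x \<noteq> x} = {}")
    case True
    then show ?thesis by (intro exI[of _ 1]) (auto simp: fun_eq_iff)
  next
    case False
    then obtain x where x: "p x \<noteq> x" by auto
    define l where "l = least_power p x"
    have l: "(p ^^ l) x = x" "l > 0"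
      using least_power_of_permutation[OF perm] by (simp_all add: l_def)
    define orb where "orb = set (support p x)"
    have card_orb: "card orb = l"
      using cycle_of_permutation[OF perm, of x] distinct_card by (fastforce simp: orb_def l_def)
    have orb: "\<exists>i. y = (p ^^ i) x" if "y \<in> orb" for y
      using that by (auto simp: orb_def)
    have inj: "inj (p ^^ i)" for i using less.prems permutes_inj permutes_funpow by blast
    have moved: "p y \<noteq> y" if mem: "y \<in> orb" for y
    proof
      obtain i where y: "y = (p ^^ i) x" using orb[OF mem] by blast
      assume "p y = y"
      then have "(p ^^ i) (p x) = (p ^^ i) x" using y by (simp add: funpow_swap1)
      then show False using x inj[of i] by (auto dest: injD)
    qed
    have fixed: "(p ^^ l) y = y" if mem: "y \<in> orb" for y
    proof -
      obtain i where y: "y = (p ^^ i) x" using orb[OF mem] by blast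
      have "(p ^^ l) y = (p ^^ i) ((p ^^ l) x)" using y by (metis add.commute comp_apply funpow_add)
      then show ?thesis using l y by simp
    qed
    have "(p ^^ l) y = y" if "p y = y" for y
      using that by (induction l) auto
    then have sub: "{y. (p ^^ l) y \<noteq> y} \<subseteq> {y. p y \<noteq> y} - orb"
      using fixed by auto
    have orb_sub: "orb \<subseteq> {y. p y \<noteq> y}" using moved by auto
    then have card: "card {y. (p ^^ l) y \<noteq> y} + l \<le> card {y. p y \<noteq> y}"
      using card_mono[OF _ sub] fin card_Diff_subset[of orb "{y. p y \<noteq> y}"] card_orb
        card_mono[OF fin orb_sub] finite_subset[OF orb_sub fin] by auto
    then obtain N where N: "N > 0" "N \<le> 2 ^ card {y. (p ^^ l) y \<noteq> y}" "(p ^^ l) ^^ N = id"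
      using less.hyps[of "p ^^ l"] l less.prems permutes_funpow by auto
    have "l * N \<le> 2 ^ l * 2 ^ card {y. (p ^^ l) y \<noteq> y}"
      using N(2) less_exp[of l] by (intro mult_mono) auto
    also have "\<dots> \<le> 2 ^ card {y. p y \<noteq> y}"
      using card by (simp flip: power_add add: add.commute)
    finally have "l * N \<le> 2 ^ card {y. p y \<noteq> y}" .
    moreover have "p ^^ (l * N) = id" using N(3) by (simp add: funpow_mult mult.commute)
    ultimately show ?thesis using N l by (intro exI[of _ "l * N"]) auto
  qed
qed

lemma conj_two_transposes:
  assumes "p permutes T"
  shows "p \<circ> (transpose a b \<circ> transpose c e) \<circ> inv' p =
    transpose (p a) (p b) \<circ> transpose (p c) (p e)"
proof -
  have "p (transpose u v x) = transpose (p u) (p v) (p x)" for u v x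
    using fun_cong[OF comp_transpose[OF permutes_inj[OF assms], of u v], of x] by simp
  then show ?thesis using permutes_inverses(1)[OF assms] by (simp add: fun_eq_iff)
qed

text \<open>Modulo \<open>N\<close> the permutation $\sigma$ is trivial, so $(x\,y)$ and its $\sigma$-conjugate
  $(\sigma x\;\sigma y)$ agree.  Unless $\sigma$ is a single transposition, this identifies two
  distinct transpositions with a common point: with $y = \sigma x$ if $\sigma$ has a cycle of length
  at least three, and otherwise by comparing two pairs of disjoint transpositions, for which the
  third cycle of an odd involution leaves room.  By conjugation all transpositions then agree modulo
  \<open>N\<close>, an odd permutation agrees with each of them, and $\sigma$ itself is trivial.\<close>

lemma transpose_in_normal_set:
  assumes fin: "finite T"
    and N: "id \<in> N" "\<And>x y. x \<in> N \<Longrightarrow> y \<in> N \<Longrightarrow> x \<circ> y \<in> N"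
    and conj: "\<And>h x. h permutes T \<Longrightarrow> x \<in> N \<Longrightarrow> h \<circ> x \<circ> inv' h \<in> N"
    and \<sigma>: "\<sigma> permutes T" "\<sigma> \<in> N" "inv' \<sigma> \<in> N" "\<not> evenperm \<sigma>"
    and ij: "i \<in> T" "j \<in> T" "i \<noteq> j"
  shows "transpose i j \<in> N"
proof -
  have inT: "\<sigma> x \<in> T" if "\<sigma> x \<noteq> x" for x
    using that \<sigma>(1) permutes_in_image permutes_not_in by metis
  have inT': "x \<in> T" if "\<sigma> x \<noteq> x" for x
    using that \<sigma>(1) permutes_not_in by metis
  have inj: "\<sigma> x = \<sigma> y \<longleftrightarrow> x = y" for x y using permutes_inj[OF \<sigma>(1)] by (auto dest: injD)
  have conjt: "transpose x y \<circ> n \<circ> transpose x y \<in> N" if "x \<in> T" "y \<in> T" "n \<in> N" for x y n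
    using conj[OF permutes_swap_id[OF that(1,2)] that(3)] by simp
  have comm: "transpose (\<sigma> x) (\<sigma> y) \<circ> transpose x y \<in> N" if "x \<in> T" "y \<in> T" for x y
  proof -
    have "\<sigma> \<circ> (transpose x y \<circ> inv' \<sigma> \<circ> transpose x y) \<in> N"
      using that \<sigma> by (intro N conjt)
    also have "\<sigma> \<circ> (transpose x y \<circ> inv' \<sigma> \<circ> transpose x y) =
        transpose (\<sigma> x) (\<sigma> y) \<circ> (\<sigma> \<circ> inv' \<sigma>) \<circ> transpose x y"
      using comp_transpose[OF permutes_inj[OF \<sigma>(1)], of x y] by (simp add: o_assoc)
    also have "\<dots> = transpose (\<sigma> x) (\<sigma> y) \<circ> transpose x y"
      using permutes_inv_o(1)[OF \<sigma>(1)] by simp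
    finally show ?thesis .
  qed
  \<comment> \<open>Two transpositions with exactly one common point that agree modulo \<open>N\<close> suffice.\<close>
  have done_if_adjacent: ?thesis
    if adj: "transpose a b \<circ> transpose b c \<in> N" "a \<in> T" "b \<in> T" "c \<in> T" "a \<noteq> b" "b \<noteq> c" "a \<noteq> c"
    for a b c
  proof -
    have A: "transpose x y \<circ> transpose y z \<in> N"
      if xyz: "x \<in> T" "y \<in> T" "z \<in> T" "x \<noteq> y" "y \<noteq> z" "x \<noteq> z" for x y z
    proof -
      let ?f = "\<lambda>u. if u = a then x else if u = b then y else z"
      have "\<exists>p. p permutes T \<and> (\<forall>u\<in>{a, b, c}. p u = ?f u)"
        using fin adj xyz by (intro permutes_extension) auto
      then obtain p where p: "p permutes T" "p a = x" "p b = y" "p c = z"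
        using adj by auto
      show ?thesis using conj[OF p(1) adj(1)] by (simp add: conj_two_transposes[OF p(1)] p)
    qed
    let ?t = "transpose i j"
    have B: "transpose u v \<circ> ?t \<in> N" if uv: "u \<in> T" "v \<in> T" "u \<noteq> v" for u v
    proof -
      consider "{u, v} = {i, j}" | "u = i" "v \<noteq> j" | "u = j" "v \<noteq> i" | "v = i" "u \<noteq> j"
        | "v = j" "u \<noteq> i" | "{u, v} \<inter> {i, j} = {}" by auto
      then show ?thesis
      proof cases
        case 1
        then have "transpose u v = ?t" by (auto simp: doubleton_eq_iff transpose_commute)
        then show ?thesis using N(1) by simp
      next
        case 2
        then show ?thesis using A[of v i j] uv ij by (auto simp: transpose_commute)
      next
        case 3
        then show ?thesis using A[of v j i] uv ij by (auto simp: transpose_commute)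
      next
        case 4
        then show ?thesis using A[of u i j] uv ij by (auto simp: transpose_commute)
      next
        case 5
        then show ?thesis using A[of u j i] uv ij by (auto simp: transpose_commute)
      next
        case 6
        then have "(transpose u v \<circ> transpose v i) \<circ> (transpose v i \<circ> ?t) \<in> N"
          using uv ij by (intro N A) auto
        also have "(transpose u v \<circ> transpose v i) \<circ> (transpose v i \<circ> ?t) = transpose u v \<circ> ?t"
          by (auto simp: fun_eq_iff)
        finally show ?thesis .
      qed
    qed
    have "(evenperm p \<longrightarrow> p \<in> N) \<and> (\<not> evenperm p \<longrightarrow> p \<circ> ?t \<in> N)" if "p permutes T" for p
      using that fin
    proof (induction rule: permutes_induct)
      case id
      then show ?case using N(1) evenperm_id by blast
    next
      case (swap u v p)
      have "permutation p" using swap.hyps(4) fin by (auto simp: permutation_permutes)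
      then have par: "evenperm (transpose u v \<circ> p) \<longleftrightarrow> \<not> evenperm p"
        using swap.hyps(3) by (simp add: evenperm_comp permutation_swap_id evenperm_swap)
      show ?case
      proof (cases "evenperm p")
        case True
        then have "p \<in> N" using swap.IH by blast
        from N(2)[OF B[OF swap.hyps(1-3)] conjt[OF ij(1,2) this]]
        have "(transpose u v \<circ> ?t) \<circ> (?t \<circ> p \<circ> ?t) \<in> N" .
        moreover have "(transpose u v \<circ> ?t) \<circ> (?t \<circ> p \<circ> ?t) = (transpose u v \<circ> p) \<circ> ?t"
          by (simp add: fun_eq_iff)
        ultimately have "(transpose u v \<circ> p) \<circ> ?t \<in> N" by (simp only:)
        then show ?thesis using par True by blast
      next
        case False
        then have "p \<circ> ?t \<in> N" using swap.IH by blast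
        from N(2)[OF B[OF swap.hyps(1-3)] conjt[OF ij(1,2) this]]
        have "(transpose u v \<circ> ?t) \<circ> (?t \<circ> (p \<circ> ?t) \<circ> ?t) \<in> N" .
        moreover have "(transpose u v \<circ> ?t) \<circ> (?t \<circ> (p \<circ> ?t) \<circ> ?t) = transpose u v \<circ> p"
          by (simp add: fun_eq_iff)
        ultimately have "transpose u v \<circ> p \<in> N" by (simp only:)
        then show ?thesis using par False by blast
      qed
    qed
    then have "inv' \<sigma> \<circ> (\<sigma> \<circ> ?t) \<in> N" using \<sigma> N(2) by blast
    then show ?thesis using permutes_inv_o(2)[OF \<sigma>(1)] by (simp add: o_assoc)
  qed
  show ?thesis
  proof (cases "\<exists>a. \<sigma> a \<noteq> a \<and> \<sigma> (\<sigma> a) \<noteq> a")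
    case True
    then obtain a where a: "\<sigma> a \<noteq> a" "\<sigma> (\<sigma> a) \<noteq> a" by blast
    have "transpose (\<sigma> (\<sigma> a)) (\<sigma> a) \<circ> transpose (\<sigma> a) a \<in> N"
      using comm[of a "\<sigma> a"] a inT inT' by (simp add: transpose_commute)
    then show ?thesis
      by (rule done_if_adjacent) (use a inT inT' inj in auto)
  next
    case invol: False
    have "\<sigma> \<noteq> id" using \<sigma>(4) by auto
    then obtain a where a: "\<sigma> a \<noteq> a" by (auto simp: fun_eq_iff)
    define b where "b = \<sigma> a"
    have ab: "\<sigma> a = b" "\<sigma> b = a" "a \<noteq> b" using invol a by (auto simp: b_def)
    show ?thesis
    proof (cases "\<sigma> = transpose a b")
      case True
      let ?f = "\<lambda>u. if u = a then i else j"
      have "\<exists>p. p permutes T \<and> (\<forall>u\<in>{a, b}. p u = ?f u)"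
        using fin ij ab inT[of a] inT'[of a] by (intro permutes_extension) auto
      then obtain p where p: "p permutes T" "p a = i" "p b = j"
        using ab by auto
      have "p \<circ> \<sigma> \<circ> inv' p = transpose i j"
        unfolding True using p comp_transpose[OF permutes_inj[OF p(1)], of a b] permutes_inv_o(1)[OF p(1)]
        by (simp add: comp_assoc)
      then show ?thesis using conj[OF p(1) \<sigma>(2)] by simp
    next
      case False
      then obtain c where "\<sigma> c \<noteq> transpose a b c" by (auto simp: fun_eq_iff)
      then have c: "\<sigma> c \<noteq> c" "c \<noteq> a" "c \<noteq> b" using ab by (auto simp: transpose_def split: if_splits)
      define e where "e = \<sigma> c"
      have ce: "\<sigma> c = e" "\<sigma> e = c" "c \<noteq> e" "e \<noteq> a" "e \<noteq> b"
        using invol c ab inj by (auto simp: e_def)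
      have "evenperm (transpose a b \<circ> transpose c e)"
        using evenperm_comp[OF permutation_swap_id permutation_swap_id, of a b c e] ab(3) ce(3)
        by (simp only: evenperm_swap simp_thms)
      then have "\<sigma> \<noteq> transpose a b \<circ> transpose c e" using \<sigma>(4) by blast
      then obtain x where "\<sigma> x \<noteq> (transpose a b \<circ> transpose c e) x" by (auto simp: fun_eq_iff)
      then have x: "\<sigma> x \<noteq> x" "x \<noteq> a" "x \<noteq> b" "x \<noteq> c" "x \<noteq> e"
        using ab ce c by (auto simp: transpose_def split: if_splits)
      have T: "a \<in> T" "b \<in> T" "c \<in> T" "e \<in> T" "x \<in> T"
        using a x c ab ce by (auto intro!: inT')
      have n1: "transpose a e \<circ> transpose b c \<in> N"
        using comm[of b c] T ab ce by simp
      have "transpose x e \<circ> transpose b c \<in> N"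
        using conj[OF permutes_swap_id[OF T(1,5)] n1]
          conj_two_transposes[OF permutes_swap_id[OF T(1,5)], of a e b c] x ab ce c by simp
      from N(2)[OF n1 this]
      have "(transpose a e \<circ> transpose b c) \<circ> (transpose x e \<circ> transpose b c) \<in> N" .
      also have "(transpose a e \<circ> transpose b c) \<circ> (transpose x e \<circ> transpose b c) =
          transpose a e \<circ> (transpose b c \<circ> transpose x e) \<circ> transpose b c"
        by (simp add: comp_assoc)
      also have "transpose b c \<circ> transpose x e = transpose x e \<circ> transpose b c"
        using comp_transpose[of "transpose b c" x e] x ce ab c by simp
      also have "transpose a e \<circ> (transpose x e \<circ> transpose b c) \<circ> transpose b c =
          transpose a e \<circ> transpose e x"
        by (simp add: fun_eq_iff transpose_commute)
      finally show ?thesis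
        by (rule done_if_adjacent) (use T x ce in auto)
    qed
  qed
qed

lemma sym_group_pow: "p [^]\<^bsub>sym_group d\<^esub> (n :: nat) = p ^^ n"
proof -
  interpret group "sym_group d" by (rule sym_group_is_group)
  show ?thesis
    by (induction n) (simp_all add: sym_group_one sym_group_mult funpow_Suc_right del: funpow.simps(2))
qed

lemma finite_sym_group: "finite (carrier (sym_group d))"
  using finite_permutations[of "{1..d}"] by (simp add: sym_group_def)

lemma order_sym_group: "order (sym_group d) = fact d"
  using card_permutations[of "{1..d}" d] by (simp add: order_def sym_group_def)

lemma odd_perm_two_fixed_points:
  assumes "\<sigma> \<in> carrier (sym_group d)" "\<not> evenperm \<sigma>" "class_fixed d \<sigma> \<ge> 2"
  shows "4 \<le> d" "card {x. \<sigma> x \<noteq> x} \<le> d - 2"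
proof -
  have \<sigma>: "\<sigma> permutes {1..d}" using assms(1) by (simp add: sym_group_carrier)
  have sub: "{x. \<sigma> x \<noteq> x} \<subseteq> {1..d}" using permutes_not_in[OF \<sigma>] by blast
  have fin: "finite {x. \<sigma> x \<noteq> x}" using finite_subset[OF sub] by simp
  have "card ({x. \<sigma> x \<noteq> x} \<union> {i \<in> {1..d}. \<sigma> i = i}) =
      card {x. \<sigma> x \<noteq> x} + card {i \<in> {1..d}. \<sigma> i = i}"
    using fin by (intro card_Un_disjoint) auto
  moreover have "{x. \<sigma> x \<noteq> x} \<union> {i \<in> {1..d}. \<sigma> i = i} = {1..d}" using sub by auto
  ultimately have sum: "card {x. \<sigma> x \<noteq> x} + class_fixed d \<sigma> = d" by (simp add: class_fixed_def)
  then show "card {x. \<sigma> x \<noteq> x} \<le> d - 2" using assms(3) by simp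
  have "\<sigma> \<noteq> id" using assms(2) by auto
  then obtain x where x: "\<sigma> x \<noteq> x" by (auto simp: fun_eq_iff)
  then have "\<sigma> (\<sigma> x) \<noteq> \<sigma> x" using permutes_inj[OF \<sigma>] by (auto dest: injD)
  then have "card {x, \<sigma> x} \<le> card {x. \<sigma> x \<noteq> x}" using x by (intro card_mono fin) auto
  then show "4 \<le> d" using x sum assms(3) by simp
qed

lemma class_order_bound:
  assumes "\<sigma> \<in> carrier (sym_group d)" "\<not> evenperm \<sigma>" "class_fixed d \<sigma> \<ge> 2"
  shows "0 < class_order d \<sigma>" "class_order d \<sigma> \<le> 2 ^ (d - 2)"
    "\<sigma> [^]\<^bsub>sym_group d\<^esub> class_order d \<sigma> = \<one>\<^bsub>sym_group d\<^esub>"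
proof -
  interpret group "sym_group d" by (rule sym_group_is_group)
  show "\<sigma> [^]\<^bsub>sym_group d\<^esub> class_order d \<sigma> = \<one>\<^bsub>sym_group d\<^esub>"
    using pow_ord_eq_1[OF assms(1)] by (simp add: class_order_def)
  show "0 < class_order d \<sigma>"
    using ord_ge_1[OF finite_sym_group assms(1)] by (simp add: class_order_def)
  have "\<sigma> permutes {1..d}" using assms(1) by (simp add: sym_group_carrier)
  then obtain N where N: "N > 0" "N \<le> 2 ^ card {x. \<sigma> x \<noteq> x}" "\<sigma> ^^ N = id"
    using permutation_power_bound by blast
  then have "class_order d \<sigma> dvd N"
    using pow_eq_id[OF assms(1), of N] by (simp add: class_order_def sym_group_pow sym_group_one)
  then have "class_order d \<sigma> \<le> N" using N(1) by (rule dvd_imp_le)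
  also note N(2)
  also have "(2::nat) ^ card {x. \<sigma> x \<noteq> x} \<le> 2 ^ (d - 2)"
    using odd_perm_two_fixed_points(2)[OF assms] by (intro power_increasing) auto
  finally show "class_order d \<sigma> \<le> 2 ^ (d - 2)" .
qed

lemma transpositions_generate:
  assumes H: "subgroup H (sym_group d)" and d: "1 \<le> d"
    and star: "\<And>i. 2 \<le> i \<Longrightarrow> i \<le> d \<Longrightarrow> transpose 1 i \<in> H"
  shows "carrier (sym_group d) \<subseteq> H"
proof
  interpret group "sym_group d" by (rule sym_group_is_group)
  have comp: "x \<circ> y \<in> H" if "x \<in> H" "y \<in> H" for x y
    using subgroup.m_closed[OF H that] by (simp add: sym_group_mult)
  have star': "transpose 1 i \<in> H" if "i \<in> {1..d}" for i
  proof (cases "i = 1")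
    case True
    then show ?thesis using subgroup.one_closed[OF H] by (simp add: sym_group_one)
  next
    case False
    then show ?thesis using star that by auto
  qed
  fix p assume "p \<in> carrier (sym_group d)"
  then have "p permutes {1..d}" by (simp add: sym_group_carrier)
  then have "p permutes {1..d}" "finite {1..d}" by simp_all
  then show "p \<in> H"
  proof (induction rule: permutes_induct)
    case id
    then show ?case using subgroup.one_closed[OF H] unfolding sym_group_one .
  next
    case (swap a b p)
    have "transpose 1 a \<circ> (transpose 1 b \<circ> transpose 1 a) \<in> H"
      using swap.hyps by (intro comp star')
    moreover have "transpose 1 a \<circ> (transpose 1 b \<circ> transpose 1 a) = transpose a b"
      if "a \<noteq> 1" "b \<noteq> 1"
      using that swap.hyps(3) by (auto simp: fun_eq_iff transpose_def)
    ultimately have "transpose a b \<in> H"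
      using star'[OF swap.hyps(1)] star'[OF swap.hyps(2)] transpose_commute[of a b] by metis
    then show ?case using swap.IH by (rule comp)
  qed
qed

text \<open>Bounds the length of chains of subgroups of the symmetric group.\<close>

lemma fact_le_power_square: "1 \<le> d \<Longrightarrow> fact d \<le> (2::nat) ^ (d - 1)\<^sup>2"
proof (induction d rule: nat_induct_at_least)
  case (Suc d)
  obtain e where e: "d = Suc e" using Suc.hyps by (cases d) auto
  have "Suc d \<le> 2 ^ d" using less_exp[of d] by (simp add: Suc_le_eq)
  also have "\<dots> \<le> 2 ^ (2 * e + 1)" using e by (intro power_increasing) auto
  finally have "fact (Suc d) \<le> (2::nat) ^ (2 * e + 1) * 2 ^ e\<^sup>2"
    using Suc.IH e by (simp only: fact_Suc of_nat_id) (intro mult_mono; simp)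
  also have "\<dots> = 2 ^ (Suc d - 1)\<^sup>2"
    using e by (simp add: power2_eq_square power_add[symmetric] algebra_simps del: power_Suc)
  finally show ?case .
qed auto

text \<open>Here \<open>n\<close> is the order of an element of the class; the inequality leaves room for
  $d\,(d-1)\,m_C$ blocks within the asserted bound.\<close>

lemma block_count_bound:
  fixes d n :: nat
  assumes "4 \<le> d" "n \<le> 2 ^ (d - 2)"
  shows "d * n \<le> 3 ^ (d - 3) * (2 * d - 1)"
proof -
  obtain e where e: "d = e + 4" using assms(1) by (metis add.commute le_Suc_ex)
  have "(e + 4) * 2 ^ (e + 2) \<le> 3 ^ (e + 1) * (2 * e + (7::nat))"
  proof -
    have "(4 * e + 16) * 2 ^ e \<le> (6 * e + 21) * (3::nat) ^ e"
      by (intro mult_mono power_mono) auto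
    then show ?thesis by (simp add: algebra_simps)
  qed
  moreover have "d * n \<le> (e + 4) * 2 ^ (e + 2)"
    using assms(2) e by (intro mult_mono) auto
  moreover have "d - 3 = e + 1" "2 * d - 1 = 2 * e + 7" using e by simp_all
  ultimately show ?thesis by (metis le_trans)
qed

text \<open>The products of elements of $C \cap \mathcal S_{d-2}$ form a set that is normalized by
  $\mathcal S_{d-2}$; it contains the inverses of these elements as they have finite order.\<close>

lemma transposition_word_exists:
  assumes \<sigma>: "\<sigma> \<in> carrier (sym_group d)" "\<not> evenperm \<sigma>" "class_fixed d \<sigma> \<ge> 2"
  shows "\<exists>w. set w \<subseteq> conj_class (sym_group d) \<sigma> \<inter>
      {p \<in> carrier (sym_group d). p (d - 1) = d - 1 \<and> p d = d} \<and>
    word_prod (sym_group d) w = transpose 1 2"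
proof -
  interpret group "sym_group d" by (rule sym_group_is_group)
  let ?S = "sym_group d"
  have d: "4 \<le> d" by (rule odd_perm_two_fixed_points[OF \<sigma>])
  define C where "C = conj_class ?S \<sigma> \<inter> {p \<in> carrier ?S. p (d - 1) = d - 1 \<and> p d = d}"
  define N where "N = {word_prod ?S w | w. set w \<subseteq> C}"
  have CC: "C \<subseteq> carrier ?S" by (auto simp: C_def)
  have CN: "x \<in> N" if "x \<in> C" for x
  proof -
    have "word_prod ?S [x] = x" using that CC by auto
    then show ?thesis using that unfolding N_def by (intro CollectI exI[of _ "[x]"]) auto
  qed
  have one: "id \<in> N"
    unfolding N_def by (intro CollectI exI[of _ "[]"]) (auto simp: sym_group_one)
  have mult: "x \<circ> y \<in> N" if xy: "x \<in> N" "y \<in> N" for x y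
  proof -
    obtain u v where u: "x = word_prod ?S u" "set u \<subseteq> C" and v: "y = word_prod ?S v" "set v \<subseteq> C"
      using xy by (auto simp: N_def)
    have "x \<circ> y = word_prod ?S (u @ v)" using u v CC by (simp add: subset_trans sym_group_mult)
    then show ?thesis using u v unfolding N_def by (intro CollectI exI[of _ "u @ v"]) auto
  qed
  have pow: "x ^^ k \<in> N" if "x \<in> N" for x k
    using that one mult by (induction k) auto
  have conj: "h \<circ> x \<circ> inv' h \<in> N" if h: "h permutes {1..d - 2}" and x: "x \<in> N" for h x
  proof -
    have hc: "h \<in> carrier ?S"
      using permutes_subset[OF h, of "{1..d}"] by (auto simp: sym_group_carrier)
    have "d - 1 \<notin> {1..d - 2}" "d \<notin> {1..d - 2}" using d by auto
    then have hfix: "h (d - 1) = d - 1" "h d = d" using permutes_not_in[OF h] by blast+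
    have hinv: "inv' h (d - 1) = d - 1" "inv' h d = d"
      using permutes_inverses(2)[OF h] hfix by metis+
    obtain u where u: "x = word_prod ?S u" "set u \<subseteq> C" using x by (auto simp: N_def)
    have "h \<otimes>\<^bsub>?S\<^esub> y \<otimes>\<^bsub>?S\<^esub> inv\<^bsub>?S\<^esub> h \<in> C" if y: "y \<in> C" for y
    proof -
      have "h \<otimes>\<^bsub>?S\<^esub> y \<otimes>\<^bsub>?S\<^esub> inv\<^bsub>?S\<^esub> h \<in> carrier ?S"
        using y hc CC by (intro m_closed inv_closed) auto
      moreover have "h \<otimes>\<^bsub>?S\<^esub> y \<otimes>\<^bsub>?S\<^esub> inv\<^bsub>?S\<^esub> h \<in> conj_class ?S \<sigma>"
        using y hc \<sigma>(1) by (intro conj_class_closed_conj) (auto simp: C_def)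
      ultimately show ?thesis
        using y hc hfix hinv by (simp add: C_def sym_group_mult)
    qed
    then have "set (conj_word h u) \<subseteq> C" using u(2) by (auto simp: conj_word_def)
    moreover have "h \<circ> x \<circ> inv' h = word_prod ?S (conj_word h u)"
      using u CC hc by (simp add: word_prod_conj_word subset_trans sym_group_mult)
    ultimately show ?thesis unfolding N_def by blast
  qed
  let ?F = "{i \<in> {1..d}. \<sigma> i = i}"
  have "\<not> card ?F \<le> Suc 0" using \<sigma>(3) unfolding class_fixed_def by simp
  then have "\<not> (\<forall>a\<in>?F. \<forall>b\<in>?F. a = b)" using card_le_Suc0_iff_eq[of ?F] by simp
  then obtain a b where ab: "a \<in> {i \<in> {1..d}. \<sigma> i = i}" "b \<in> {i \<in> {1..d}. \<sigma> i = i}" "a \<noteq> b"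
    by blast
  let ?f = "\<lambda>x. if x = a then d - 1 else d"
  have "\<exists>h. h permutes {1..d} \<and> (\<forall>x\<in>{a, b}. h x = ?f x)"
    using ab d by (intro permutes_extension) auto
  then obtain h where h: "h permutes {1..d}" "h a = d - 1" "h b = d" using ab by auto
  have hc: "h \<in> carrier ?S" using h by (simp add: sym_group_carrier)
  let ?\<tau> = "h \<otimes>\<^bsub>?S\<^esub> \<sigma> \<otimes>\<^bsub>?S\<^esub> inv\<^bsub>?S\<^esub> h"
  have \<tau>: "?\<tau> = h \<circ> \<sigma> \<circ> inv' h" using hc by (simp add: sym_group_mult)
  have hinv: "inv' h (d - 1) = a" "inv' h d = b"
    using permutes_inverses(2)[OF h(1)] h by metis+
  have fixes_top: "?\<tau> (d - 1) = d - 1" "?\<tau> d = d" unfolding \<tau> using hinv ab h by auto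
  have \<tau>c: "?\<tau> \<in> carrier ?S" using hc \<sigma>(1) by (intro m_closed inv_closed)
  have "?\<tau> \<in> conj_class ?S \<sigma>" using hc unfolding conj_class_def by blast
  then have \<tau>C: "?\<tau> \<in> C" using fixes_top \<tau>c by (simp add: C_def)
  have "?\<tau> permutes {1..d - 2}"
  proof (rule permutes_superset)
    show "?\<tau> permutes {1..d}" using \<tau>c by (simp add: sym_group_carrier)
    show "?\<tau> x = x" if "x \<in> {1..d} - {1..d - 2}" for x
    proof -
      have "x = d - 1 \<or> x = d" using that by auto
      then show ?thesis using fixes_top by auto
    qed
  qed
  moreover have "inv' ?\<tau> \<in> N"
  proof -
    let ?n = "ord ?\<tau>"
    have "?n \<ge> 1" by (rule ord_ge_1[OF finite_sym_group \<tau>c])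
    then have "?\<tau> [^]\<^bsub>?S\<^esub> (?n - 1) \<otimes>\<^bsub>?S\<^esub> ?\<tau> = \<one>\<^bsub>?S\<^esub>"
      using pow_ord_eq_1[OF \<tau>c] nat_pow_Suc[of ?\<tau> "?n - 1"] by simp
    then have "inv\<^bsub>?S\<^esub> ?\<tau> = ?\<tau> [^]\<^bsub>?S\<^esub> (?n - 1)"
      using \<tau>c by (intro inv_equality) auto
    then have "inv' ?\<tau> = ?\<tau> ^^ (?n - 1)"
      using sym_group_inv_equality[OF \<tau>c] by (simp only: sym_group_pow)
    then show ?thesis using pow[OF CN[OF \<tau>C]] by (simp only:)
  qed
  moreover have "\<not> evenperm ?\<tau>"
  proof -
    have "permutation h" "permutation \<sigma>" "permutation (inv' h)"
      using sym_group_carrier'[OF hc] sym_group_carrier'[OF \<sigma>(1)] permutation_inverse by auto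
    then show ?thesis
      unfolding \<tau> using \<sigma>(2) by (simp add: evenperm_comp permutation_compose evenperm_inv)
  qed
  ultimately have "transpose 1 2 \<in> N"
    using d CN[OF \<tau>C]
    by (intro transpose_in_normal_set[where T = "{1..d - 2}" and \<sigma> = ?\<tau>] one mult conj) auto
  then show ?thesis unfolding N_def C_def by force
qed


section \<open>Fake transpositions\<close>

text \<open>A word \<open>w\<close> with product $(1\,2)$ is to play the role of the letter $x_{(1\,2)}$.  The word \<open>R\<close> is the
  environment that makes this possible: it is central, generates the group, is equivalent to all its
  conjugates, and begins with \<open>w\<close>, hence can be made to begin with any conjugate of \<open>w\<close>.\<close>

locale fake_transpositions = group "sym_group d" for d +
  fixes w R :: "(nat \<Rightarrow> nat) list"
  assumes d: "4 \<le> d"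
    and w_closed: "set w \<subseteq> carrier (sym_group d)"
    and w_prod: "word_prod (sym_group d) w = transpose 1 2"
    and w_fix: "\<And>x. x \<in> set w \<Longrightarrow> x (d - 1) = d - 1 \<and> x d = d"
    and R_closed: "set R \<subseteq> carrier (sym_group d)"
    and R_prod: "word_prod (sym_group d) R = \<one>\<^bsub>sym_group d\<^esub>"
    and R_generate: "generate (sym_group d) (set R) = carrier (sym_group d)"
    and R_conj: "\<And>g. g \<in> carrier (sym_group d) \<Longrightarrow> word_eq R (conj_word g R)"
    and R_split: "\<exists>rest. word_eq R (w @ rest)"
begin

notation word_eq (infix "\<doteq>" 50)
\<comment> \<open>Keeps inverses in the form to which the lemmas about groups apply.\<close>
declare sym_group_inv_equality [simp del] One_nat_def [simp del]

abbreviation S where "S \<equiv> sym_group d"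

lemmas S_mult = sym_group_mult[of d]
lemmas S_one = sym_group_one[of d]
lemmas S_conj_transpose = sym_group_conj_transpose[of _ d]

lemma carrier_range: "g \<in> carrier S \<Longrightarrow> i \<in> {1..d} \<Longrightarrow> g i \<in> {1..d}"
  using permutes_in_image[of g "{1..d}" i] by (simp add: sym_group_carrier)

lemma carrier_inj: "g \<in> carrier S \<Longrightarrow> g i = g j \<longleftrightarrow> i = j"
  using permutes_inj[of g "{1..d}"] by (auto simp: sym_group_carrier dest: injD)

text \<open>The fake transposition over $(g(1)\;g(2))$ obtained by conjugating \<open>w\<close> with \<open>g\<close>.\<close>

definition fake :: "(nat \<Rightarrow> nat) \<Rightarrow> (nat \<Rightarrow> nat) list"
  where "fake g = conj_word g w"

definition fakes :: "(nat \<Rightarrow> nat) list \<Rightarrow> (nat \<Rightarrow> nat) list"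
  where "fakes gs = concat (map fake gs)"

lemma fakes_simps [simp]:
  "fakes [] = []" "fakes (g # gs) = fake g @ fakes gs" "fakes (gs @ hs) = fakes gs @ fakes hs"
  by (simp_all add: fakes_def)

lemma fake_closed [simp]: "g \<in> carrier S \<Longrightarrow> set (fake g) \<subseteq> carrier S"
  using w_closed by (simp add: fake_def)

lemma fakes_closed [simp]: "set gs \<subseteq> carrier S \<Longrightarrow> set (fakes gs) \<subseteq> carrier S"
  by (induction gs) auto

lemma word_prod_fake: "g \<in> carrier S \<Longrightarrow> word_prod S (fake g) = transpose (g 1) (g 2)"
  using w_closed by (simp add: fake_def word_prod_conj_word w_prod S_conj_transpose)

lemma fake_transpose_closed: "g \<in> carrier S \<Longrightarrow> transpose (g 1) (g 2) \<in> carrier S"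
  using d carrier_range[of g] by (intro transpose_in_sym_group) auto

lemma conj_word_fake:
  "h \<in> carrier S \<Longrightarrow> g \<in> carrier S \<Longrightarrow> conj_word h (fake g) = fake (h \<otimes>\<^bsub>S\<^esub> g)"
  using w_closed by (simp add: fake_def conj_word_conj_word)

lemma conj_word_fakes:
  "h \<in> carrier S \<Longrightarrow> set gs \<subseteq> carrier S \<Longrightarrow>
    conj_word h (fakes gs) = fakes (map (\<lambda>g. h \<otimes>\<^bsub>S\<^esub> g) gs)"
  by (induction gs) (auto simp: conj_word_fake)

lemma fake_one: "fake \<one>\<^bsub>S\<^esub> = w"
  using w_closed by (simp add: fake_def)

text \<open>Equivalence of words in the presence of \<open>R\<close>.  As \<open>R\<close> is central and stable under conjugation, this
  is again a congruence that is stable under conjugation.\<close>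

definition eqR :: "(nat \<Rightarrow> nat) list \<Rightarrow> (nat \<Rightarrow> nat) list \<Rightarrow> bool" (infix "\<triangleq>" 50)
  where "u \<triangleq> v \<longleftrightarrow> R @ u \<doteq> R @ v"

lemma eqR_closed: "u \<triangleq> v \<Longrightarrow> set u \<subseteq> carrier S" "u \<triangleq> v \<Longrightarrow> set v \<subseteq> carrier S"
  using word_eq_closed[of "R @ u" "R @ v"] by (auto simp: eqR_def)

lemma eqR_refl [simp]: "set u \<subseteq> carrier S \<Longrightarrow> u \<triangleq> u"
  using R_closed by (simp add: eqR_def)

lemma eqR_sym: "u \<triangleq> v \<Longrightarrow> v \<triangleq> u"
  by (simp add: eqR_def word_eq_sym)

lemma eqR_trans [trans]: "u \<triangleq> v \<Longrightarrow> v \<triangleq> x \<Longrightarrow> u \<triangleq> x"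
  unfolding eqR_def by (rule word_eq_trans)

lemma eqR_if_word_eq: "u \<doteq> v \<Longrightarrow> u \<triangleq> v"
  using R_closed by (simp add: eqR_def word_eq_appendL)

lemma eqR_word_eq_trans [trans]: "u \<triangleq> v \<Longrightarrow> v \<doteq> x \<Longrightarrow> u \<triangleq> x" "u \<doteq> v \<Longrightarrow> v \<triangleq> x \<Longrightarrow> u \<triangleq> x"
  using eqR_if_word_eq eqR_trans by blast+

lemma R_central: "set u \<subseteq> carrier S \<Longrightarrow> R @ u \<doteq> u @ R"
  using R_closed R_prod by (simp add: word_central)

lemma eqR_iff_right:
  assumes "set u \<subseteq> carrier S" "set v \<subseteq> carrier S"
  shows "u \<triangleq> v \<longleftrightarrow> u @ R \<doteq> v @ R"
  unfolding eqR_def using R_central[OF assms(1)] R_central[OF assms(2)]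
    word_eq_sym word_eq_trans by blast

lemma eqR_appendR: "u \<triangleq> v \<Longrightarrow> set x \<subseteq> carrier S \<Longrightarrow> u @ x \<triangleq> v @ x"
  unfolding eqR_def using word_eq_appendR[of "R @ u" "R @ v" x] by simp

lemma eqR_appendL:
  assumes "u \<triangleq> v" "set x \<subseteq> carrier S" shows "x @ u \<triangleq> x @ v"
proof -
  note c = eqR_closed[OF assms(1)]
  have "x @ u @ R \<doteq> x @ v @ R"
    using assms c by (intro word_eq_appendL) (auto simp: eqR_iff_right)
  then show ?thesis using assms c by (simp add: eqR_iff_right)
qed

lemma eqR_append: "u \<triangleq> u' \<Longrightarrow> v \<triangleq> v' \<Longrightarrow> u @ v \<triangleq> u' @ v'"
  by (rule eqR_trans[OF eqR_appendR eqR_appendL]) (auto dest: eqR_closed)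

lemma eqR_prod:
  assumes "u \<triangleq> v" shows "word_prod S u = word_prod S v"
  using assms word_eq_prod[of "R @ u" "R @ v"] eqR_closed[OF assms] R_closed R_prod
  by (simp add: eqR_def)

lemma eqR_conj:
  assumes "u \<triangleq> v" "g \<in> carrier S" shows "conj_word g u \<triangleq> conj_word g v"
proof -
  note c = eqR_closed[OF assms(1)]
  have "R @ conj_word g u \<doteq> conj_word g R @ conj_word g u"
    using assms c by (intro word_eq_appendR R_conj) auto
  also have "\<dots> \<doteq> conj_word g R @ conj_word g v"
    using word_eq_conj_word[of "R @ u" "R @ v" g] assms by (simp add: eqR_def)
  also have "\<dots> \<doteq> R @ conj_word g v"
    using assms c by (intro word_eq_appendR word_eq_sym[OF R_conj]) auto
  finally show ?thesis by (simp add: eqR_def)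
qed

lemma eqR_conj_central:
  assumes "set u \<subseteq> carrier S" "word_prod S u = \<one>\<^bsub>S\<^esub>" "g \<in> carrier S"
  shows "u \<triangleq> conj_word g u"
  using assms R_closed R_generate by (simp add: eqR_iff_right central_word_conj)

lemma conj_word_w: "conj_word (transpose (d - 1) d) w = w"
proof -
  let ?t = "transpose (d - 1) d"
  have t: "?t \<in> carrier S" using d by (intro transpose_in_sym_group) auto
  have "?t \<otimes>\<^bsub>S\<^esub> x \<otimes>\<^bsub>S\<^esub> inv\<^bsub>S\<^esub> ?t = x" if "x \<in> set w" for x
  proof -
    have x: "x \<in> carrier S" using that w_closed by auto
    have "x \<otimes>\<^bsub>S\<^esub> ?t \<otimes>\<^bsub>S\<^esub> inv\<^bsub>S\<^esub> x = ?t"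
      using S_conj_transpose[OF x] w_fix[OF that] by simp
    then have "x \<otimes>\<^bsub>S\<^esub> ?t = ?t \<otimes>\<^bsub>S\<^esub> x"
      using x t by (metis inv_solve_right' m_closed)
    then show ?thesis using x t by (metis inv_solve_right' m_closed)
  qed
  then show ?thesis by (simp add: conj_word_def map_idI)
qed

text \<open>Here the two points fixed by all letters of \<open>w\<close> matter.  Let $\tau$ be the transposition under
  \<open>fake g\<close> and $\rho = (i\;j)$ disjoint from it.  Choose \<open>p\<close> such that \<open>fake p\<close> lies over $\rho$ and its letters
  fix both points moved by $\tau$; then \<open>fake p\<close> is unchanged by conjugation with $\tau$.  Exchanging
  \<open>fake g\<close> and \<open>fake p\<close>, first conjugating \<open>fake p\<close> by $\tau$ and then \<open>fake g\<close> by $\rho$, leads back to the same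
  order with \<open>fake g\<close> conjugated by $\rho$.  The auxiliary \<open>fake p\<close> is borrowed from \<open>R\<close>.\<close>

lemma fake_disjoint:
  assumes g: "g \<in> carrier S" and ij: "i \<in> {1..d}" "j \<in> {1..d}" "i \<noteq> j"
    and disj: "{i, j} \<inter> {g 1, g 2} = {}"
  shows "fake g \<triangleq> fake (transpose i j \<otimes>\<^bsub>S\<^esub> g)"
proof -
  define f where "f k = (if k = 1 then i else if k = 2 then j else if k = d - 1 then g 1 else g 2)"
    for k
  have ne: "d - 1 \<noteq> 1" "d - 1 \<noteq> 2" "d \<noteq> d - 1" "d \<noteq> 1" "d \<noteq> 2" using d by auto
  have f: "f 1 = i" "f 2 = j" "f (d - 1) = g 1" "f d = g 2" using ne by (simp_all add: f_def)
  have g12: "g 1 \<noteq> g 2" "g 1 \<in> {1..d}" "g 2 \<in> {1..d}"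
    using carrier_inj[OF g] carrier_range[OF g] d by auto
  have "\<exists>p. p permutes {1..d} \<and> (\<forall>x\<in>{1, 2, d - 1, d}. p x = f x)"
  proof (rule permutes_extension)
    show "inj_on f {1, 2, d - 1, d}" using f g12(1) ij(3) disj by auto
    show "f ` {1, 2, d - 1, d} \<subseteq> {1..d}" using f g12 ij by auto
  qed (use d in auto)
  then obtain p where p: "p \<in> carrier S" "p 1 = i" "p 2 = j" "p (d - 1) = g 1" "p d = g 2"
    using f by (auto simp: sym_group_carrier)
  let ?\<rho> = "transpose i j" and ?\<tau> = "transpose (g 1) (g 2)" and ?\<delta> = "transpose (d - 1) d"
  have c: "?\<rho> \<in> carrier S" "?\<tau> \<in> carrier S" "?\<delta> \<in> carrier S"
    using ij d fake_transpose_closed[OF g] by (auto intro!: transpose_in_sym_group)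
  have \<tau>p: "?\<tau> \<otimes>\<^bsub>S\<^esub> p = p \<otimes>\<^bsub>S\<^esub> ?\<delta>"
    using S_conj_transpose[OF p(1), of "d - 1" d] p c by (metis inv_solve_right' m_closed)
  have "conj_word ?\<tau> (fake p) = conj_word p (conj_word ?\<delta> w)"
    using p c w_closed \<tau>p by (simp add: fake_def conj_word_conj_word)
  then have stab: "conj_word ?\<tau> (fake p) = fake p" by (simp only: conj_word_w fake_def)
  have "fake g @ fake p \<doteq> fake p @ fake g"
    using word_swap'[of "fake g" "fake p"] g p stab by (simp add: word_prod_fake)
  also have "\<dots> \<doteq> conj_word ?\<rho> (fake g) @ fake p"
    using word_swap'[of "fake p" "fake g"] g p by (simp add: word_prod_fake)
  finally have swap: "fake g @ fake p \<doteq> fake (?\<rho> \<otimes>\<^bsub>S\<^esub> g) @ fake p"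
    using c g by (simp add: conj_word_fake)
  obtain rest where rest: "R \<doteq> w @ rest" using R_split by blast
  have rc: "set rest \<subseteq> carrier S" using word_eq_closed[OF rest] by simp
  let ?r = "conj_word p rest"
  have R: "R \<doteq> fake p @ ?r"
    using word_eq_trans[OF R_conj[OF p(1)] word_eq_conj_word[OF rest p(1)]] by (simp add: fake_def)
  have "fake g @ R \<doteq> fake g @ fake p @ ?r"
    using R g by (intro word_eq_appendL) auto
  also have "\<dots> \<doteq> fake (?\<rho> \<otimes>\<^bsub>S\<^esub> g) @ fake p @ ?r"
    using word_eq_appendR[OF swap, of ?r] rc p by simp
  also have "\<dots> \<doteq> fake (?\<rho> \<otimes>\<^bsub>S\<^esub> g) @ R"
    using R c g by (intro word_eq_appendL word_eq_sym[OF R]) auto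
  finally show ?thesis using c g by (simp add: eqR_iff_right)
qed

text \<open>The permutations that fix 1 and 2 are products of transpositions disjoint from $(1\,2)$.\<close>

lemma fake_stabilizer:
  assumes "c \<in> carrier S" "c 1 = 1" "c 2 = 2"
  shows "fake c \<triangleq> w"
proof -
  have "c permutes {3..d}"
  proof (rule permutes_superset)
    show "c permutes {1..d}" using assms(1) by (simp add: sym_group_carrier)
    show "c x = x" if "x \<in> {1..d} - {3..d}" for x
    proof -
      have "x = 1 \<or> x = 2" using that by auto
      then show ?thesis using assms by auto
    qed
  qed
  moreover have "finite {3..d}" by simp
  ultimately show ?thesis
  proof (induction rule: permutes_induct)
    case id
    have "fake id = w" using fake_one by (simp only: S_one)
    then show ?case using w_closed by (simp only: eqR_refl)
  next
    case (swap a b p)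
    have p: "p \<in> carrier S"
      using permutes_subset[OF swap.hyps(4), of "{1..d}"] by (simp add: sym_group_carrier)
    have p12: "p 1 = 1" "p 2 = 2" using permutes_not_in[OF swap.hyps(4)] by auto
    have "fake p \<triangleq> fake (transpose a b \<otimes>\<^bsub>S\<^esub> p)"
      using swap.hyps(1-3) p p12 by (intro fake_disjoint) auto
    from eqR_trans[OF eqR_sym[OF this] swap.IH] show ?case by (simp only: S_mult)
  qed
qed

text \<open>In the presence of \<open>R\<close> a fake transposition depends only on the transposition under it.  The
  element $(1\,2)$, which also centralizes $(1\,2)$, is dealt with by rotating \<open>w\<close> once around.\<close>

lemma fake_cong:
  assumes g: "g \<in> carrier S" and h: "h \<in> carrier S"
    and eq: "transpose (g 1) (g 2) = transpose (h 1) (h 2)"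
  shows "fake g \<triangleq> fake h"
proof -
  have same: "fake g \<triangleq> fake h" if g: "g \<in> carrier S" and "g 1 = h 1" "g 2 = h 2" for g
  proof -
    let ?c = "inv\<^bsub>S\<^esub> h \<otimes>\<^bsub>S\<^esub> g"
    have hp: "h permutes {1..d}" using h by (simp add: sym_group_carrier)
    have c: "?c \<in> carrier S" using g h by simp
    moreover have "?c 1 = 1" "?c 2 = 2"
      using that h permutes_inverses(2)[OF hp]
      by (simp_all add: S_mult sym_group_inv_equality)
    ultimately have "conj_word h (fake ?c) \<triangleq> conj_word h w"
      using h by (intro eqR_conj fake_stabilizer) auto
    then show ?thesis
      using g h c by (simp add: conj_word_fake m_assoc[symmetric] fake_def[symmetric])
  qed
  have "g 1 \<noteq> g 2" using carrier_inj[OF g] by simp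
  then consider "g 1 = h 1" "g 2 = h 2" | "g 1 = h 2" "g 2 = h 1"
    using transpose_eqD[OF eq] by blast
  then show ?thesis
  proof cases
    case 1
    then show ?thesis using same g by blast
  next
    case 2
    let ?t = "transpose 1 2 :: nat \<Rightarrow> nat"
    have t: "?t \<in> carrier S" using d by (intro transpose_in_sym_group) auto
    have "w \<doteq> conj_word ?t w" using word_eq_conj_prod[OF w_closed] w_prod by simp
    from word_eq_conj_word[OF this g] have "fake g \<doteq> fake (g \<otimes>\<^bsub>S\<^esub> ?t)"
      using g t w_closed by (simp add: fake_def conj_word_conj_word)
    also have "fake (g \<otimes>\<^bsub>S\<^esub> ?t) \<triangleq> fake h"
      using m_closed[OF g t] 2 by (intro same) (auto simp: S_mult)
    finally show ?thesis .
  qed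
qed

lemma fake_swap:
  assumes "g \<in> carrier S" "h \<in> carrier S"
  shows "fake g @ fake h \<doteq> fake (transpose (g 1) (g 2) \<otimes>\<^bsub>S\<^esub> h) @ fake g"
    and "fake g @ fake h \<doteq> fake h @ fake (transpose (h 1) (h 2) \<otimes>\<^bsub>S\<^esub> g)"
proof -
  have c: "transpose (g 1) (g 2) \<in> carrier S" "transpose (h 1) (h 2) \<in> carrier S"
    using assms by (auto intro: fake_transpose_closed)
  have "inv\<^bsub>S\<^esub> (transpose (h 1) (h 2)) = transpose (h 1) (h 2)"
    using c by (intro inv_equality) (auto simp: S_mult S_one)
  then show "fake g @ fake h \<doteq> fake h @ fake (transpose (h 1) (h 2) \<otimes>\<^bsub>S\<^esub> g)"
    using word_swap[of "fake g" "fake h"] assms c by (simp add: word_prod_fake conj_word_fake)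
  show "fake g @ fake h \<doteq> fake (transpose (g 1) (g 2) \<otimes>\<^bsub>S\<^esub> h) @ fake g"
    using word_swap'[of "fake g" "fake h"] assms c by (simp add: word_prod_fake conj_word_fake)
qed

text \<open>The fake transpositions over the transpositions of $\{1,\dots,m\}$.\<close>

definition level :: "nat \<Rightarrow> (nat \<Rightarrow> nat) set"
  where "level m = {g \<in> carrier S. g 1 \<le> m \<and> g 2 \<le> m}"

lemma level_closed: "level m \<subseteq> carrier S"
  by (auto simp: level_def)

lemma word_prod_fakes_above:
  assumes "set gs \<subseteq> level m" "m < x"
  shows "word_prod S (fakes gs) x = x"
  using assms(1)
proof (induction gs)
  case (Cons g gs)
  then have c: "g \<in> carrier S" "set gs \<subseteq> carrier S" "g 1 \<le> m" "g 2 \<le> m"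
    using level_closed by (auto simp: level_def)
  then have "word_prod S (fakes (g # gs)) = transpose (g 1) (g 2) \<circ> word_prod S (fakes gs)"
    using word_prod_fake by (simp add: S_mult)
  with Cons c assms(2) show ?case by (simp add: transpose_def)
qed (simp add: S_one)

text \<open>At most one factor needs to move the top point $m+1$.  Two factors over $(m{+}1\;a)$ and
  $(m{+}1\;b)$ with $a \neq b$ are exchanged so that only the first still moves $m+1$.  If
  $a = b$, the pair has product one, and the environment \<open>R\<close> allows one to conjugate both factors
  to fake transpositions over $(1\,2)$.\<close>

lemma reduce_level:
  assumes m: "2 \<le> m" and gs: "set gs \<subseteq> level (Suc m)"
  shows "\<exists>hs. length hs = length gs \<and> fakes gs \<triangleq> fakes hs \<and>
    (set hs \<subseteq> level m \<or>
      (\<exists>h hs'. hs = h # hs' \<and> h \<in> carrier S \<and> h 1 = Suc m \<and> h 2 \<le> m \<and> set hs' \<subseteq> level m))"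
  using gs
proof (induction gs)
  case Nil
  then show ?case by auto
next
  case (Cons g gs)
  then obtain hs where hs: "length hs = length gs" "fakes gs \<triangleq> fakes hs"
    and alt: "set hs \<subseteq> level m \<or>
      (\<exists>h hs'. hs = h # hs' \<and> h \<in> carrier S \<and> h 1 = Suc m \<and> h 2 \<le> m \<and> set hs' \<subseteq> level m)"
    by auto
  have g: "g \<in> carrier S" "g 1 \<le> Suc m" "g 2 \<le> Suc m" using Cons.prems by (auto simp: level_def)
  have step: "fakes (g # gs) \<triangleq> fake g @ fakes hs"
    using hs(2) g by (simp add: eqR_appendL)
  show ?case
  proof (cases "g \<in> level m")
    case True
    show ?thesis
      using alt
    proof (elim disjE exE conjE)
      assume "set hs \<subseteq> level m"
      then show ?thesis using hs True step by (intro exI[of _ "g # hs"]) auto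
    next
      fix h hs' assume h: "hs = h # hs'" "h \<in> carrier S" "h 1 = Suc m" "h 2 \<le> m" "set hs' \<subseteq> level m"
      let ?h = "transpose (g 1) (g 2) \<otimes>\<^bsub>S\<^esub> h"
      have c: "?h \<in> carrier S" "?h 1 = Suc m" "?h 2 \<le> m"
        using g h True fake_transpose_closed[OF g(1)]
        by (auto simp: S_mult level_def transpose_def intro!: m_closed[unfolded S_mult])
      have "fake g @ fake h @ fakes hs' \<doteq> fake ?h @ fake g @ fakes hs'"
        using word_eq_appendR[OF fake_swap(1)[OF g(1) h(2)], of "fakes hs'"] h level_closed[of m]
        by (simp add: subset_trans)
      then have "fakes (g # gs) \<triangleq> fakes (?h # g # hs')"
        using eqR_word_eq_trans(1)[OF step] h by simp
      then show ?thesis using hs h c True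
        by (intro exI[of _ "?h # g # hs'"]) auto
    qed
  next
    case False
    let ?t = "transpose 1 2 :: nat \<Rightarrow> nat"
    have t: "?t \<in> carrier S" using d by (intro transpose_in_sym_group) auto
    have "g 1 \<noteq> g 2" using carrier_inj[OF g(1)] by simp
    then have "\<exists>k\<in>carrier S. k 1 = Suc m \<and> k 2 \<le> m \<and> fake g \<triangleq> fake k"
    proof (cases "g 1 = Suc m")
      case True
      then show ?thesis using g \<open>g 1 \<noteq> g 2\<close> by (intro bexI[of _ g]) auto
    next
      case other: False
      have "fake g \<triangleq> fake (g \<otimes>\<^bsub>S\<^esub> ?t)"
        using g m_closed[OF g(1) t] by (intro fake_cong) (auto simp: S_mult transpose_commute)
      moreover have "g 2 = Suc m" "g 1 \<le> m" using False g other by (auto simp: level_def)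
      ultimately show ?thesis
        using m_closed[OF g(1) t] by (intro bexI[of _ "g \<otimes>\<^bsub>S\<^esub> ?t"]) (auto simp: S_mult)
    qed
    then obtain k where k: "k \<in> carrier S" "k 1 = Suc m" "k 2 \<le> m" "fake g \<triangleq> fake k" by blast
    have hsc: "set hs \<subseteq> carrier S" using alt level_closed[of m] by auto
    have step': "fakes (g # gs) \<triangleq> fake k @ fakes hs"
      using eqR_trans[OF step eqR_appendR[OF k(4)]] hsc by simp
    show ?thesis
      using alt
    proof (elim disjE exE conjE)
      assume "set hs \<subseteq> level m"
      then show ?thesis using hs k step' by (intro exI[of _ "k # hs"]) auto
    next
      fix h hs' assume h: "hs = h # hs'" "h \<in> carrier S" "h 1 = Suc m" "h 2 \<le> m" "set hs' \<subseteq> level m"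
      have hsc': "set (fakes hs') \<subseteq> carrier S" using h(5) level_closed[of m] by auto
      show ?thesis
      proof (cases "k 2 = h 2")
        case True
        have "fake k @ fake h \<triangleq> fake h @ fake h"
          using k h True by (intro eqR_appendR fake_cong) auto
        also have "\<dots> \<triangleq> conj_word (inv\<^bsub>S\<^esub> h) (fake h @ fake h)"
          using h fake_transpose_closed[OF h(2)]
          by (intro eqR_conj_central) (auto simp: word_prod_fake S_mult S_one)
        also have "conj_word (inv\<^bsub>S\<^esub> h) (fake h @ fake h) = fake \<one>\<^bsub>S\<^esub> @ fake \<one>\<^bsub>S\<^esub>"
          using h by (simp add: conj_word_fake)
        finally have "fakes (g # gs) \<triangleq> fakes (\<one>\<^bsub>S\<^esub> # \<one>\<^bsub>S\<^esub> # hs')"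
          using eqR_trans[OF step'] h eqR_appendR[OF _ hsc'] by fastforce
        moreover have "\<one>\<^bsub>S\<^esub> \<in> level m" using m by (simp add: level_def S_one[symmetric]) (simp add: S_one)
        ultimately show ?thesis using hs h
          by (intro exI[of _ "\<one>\<^bsub>S\<^esub> # \<one>\<^bsub>S\<^esub> # hs'"]) auto
      next
        case False
        let ?k = "transpose (h 1) (h 2) \<otimes>\<^bsub>S\<^esub> k"
        have "?k \<in> carrier S" using k fake_transpose_closed[OF h(2)] by simp
        then have kl: "?k \<in> level m"
          using k h False by (auto simp: level_def S_mult transpose_def)
        have "fake k @ fake h @ fakes hs' \<doteq> fake h @ fake ?k @ fakes hs'"
          using word_eq_appendR[OF fake_swap(2)[OF k(1) h(2)] hsc'] by simp
        then have "fakes (g # gs) \<triangleq> fakes (h # ?k # hs')"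
          using eqR_word_eq_trans(1)[OF step'] h by simp
        then show ?thesis using hs h kl by (intro exI[of _ "h # ?k # hs'"]) auto
      qed
    qed
  qed
qed

text \<open>Peeling off one point at a time: after \<open>reduce_level\<close>, the image of the top point under the product
  tells whether a factor moving that point is left, and over which transposition it lies.\<close>

lemma fakes_level_unique:
  assumes "2 \<le> m" "m \<le> d" "set gs \<subseteq> level m" "set hs \<subseteq> level m"
    and "length gs = length hs" "word_prod S (fakes gs) = word_prod S (fakes hs)"
  shows "fakes gs \<triangleq> fakes hs"
  using assms
proof (induction m arbitrary: gs hs rule: nat_induct_at_least)
  case base
  have "fakes gs \<triangleq> concat (replicate (length gs) w)" if "set gs \<subseteq> level 2" for gs
    using that
  proof (induction gs)
    case (Cons g gs)
    then have g: "g \<in> carrier S" "g 1 \<le> 2" "g 2 \<le> 2" by (auto simp: level_def)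
    moreover have "g 1 \<ge> 1" "g 2 \<ge> 1" "g 1 \<noteq> g 2"
      using carrier_range[OF g(1)] carrier_inj[OF g(1)] d by auto
    ultimately have "g 1 = 1 \<and> g 2 = 2 \<or> g 1 = 2 \<and> g 2 = 1" by linarith
    then have "transpose (g 1) (g 2) = transpose (\<one>\<^bsub>S\<^esub> 1) (\<one>\<^bsub>S\<^esub> 2)"
      by (auto simp: S_one transpose_commute)
    then have "fake g \<triangleq> w" using fake_cong[OF g(1) one_closed] fake_one by simp
    then show ?case using Cons by (auto intro: eqR_append)
  qed auto
  from this[OF base(2)] this[OF base(3)] base(4) show ?case
    using eqR_sym eqR_trans by metis
next
  case (Suc m)
  obtain gs' where gs': "length gs' = length gs" "fakes gs \<triangleq> fakes gs'"
    and altg: "set gs' \<subseteq> level m \<or>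
      (\<exists>h hs'. gs' = h # hs' \<and> h \<in> carrier S \<and> h 1 = Suc m \<and> h 2 \<le> m \<and> set hs' \<subseteq> level m)"
    using reduce_level[OF Suc.hyps Suc.prems(2)] by blast
  obtain hs' where hs': "length hs' = length hs" "fakes hs \<triangleq> fakes hs'"
    and alth: "set hs' \<subseteq> level m \<or>
      (\<exists>h ks. hs' = h # ks \<and> h \<in> carrier S \<and> h 1 = Suc m \<and> h 2 \<le> m \<and> set ks \<subseteq> level m)"
    using reduce_level[OF Suc.hyps Suc.prems(3)] by blast
  have prod: "word_prod S (fakes gs') = word_prod S (fakes hs')"
    using eqR_prod[OF gs'(2)] eqR_prod[OF hs'(2)] Suc.prems(5) by simp
  have moved: "word_prod S (fakes (h # ks)) (Suc m) = h 2"
    if "h \<in> carrier S" "h 1 = Suc m" "set ks \<subseteq> level m" for h ks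
  proof -
    have "set ks \<subseteq> carrier S" using that level_closed by blast
    then show ?thesis
      using that word_prod_fakes_above[OF that(3), of "Suc m"]
      by (simp add: word_prod_fake S_mult)
  qed
  have above: "word_prod S (fakes ks) (Suc m) = Suc m" if "set ks \<subseteq> level m" for ks
    using word_prod_fakes_above[OF that] by simp
  have "fakes gs' \<triangleq> fakes hs'"
    using altg
  proof (elim disjE exE conjE)
    assume g: "set gs' \<subseteq> level m"
    show ?thesis
      using alth
    proof (elim disjE exE conjE)
      assume "set hs' \<subseteq> level m"
      then show ?thesis using Suc g prod gs' hs' by simp
    next
      fix h ks assume h: "hs' = h # ks" "h \<in> carrier S" "h 1 = Suc m" "h 2 \<le> m" "set ks \<subseteq> level m"
      then show ?thesis using moved[OF h(2,3,5)] above[OF g] prod by simp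
    qed
  next
    fix k ks assume k: "gs' = k # ks" "k \<in> carrier S" "k 1 = Suc m" "k 2 \<le> m" "set ks \<subseteq> level m"
    show ?thesis
      using alth
    proof (elim disjE exE conjE)
      assume "set hs' \<subseteq> level m"
      then show ?thesis using moved[OF k(2,3,5)] above[of hs'] prod k by simp
    next
      fix h js assume h: "hs' = h # js" "h \<in> carrier S" "h 1 = Suc m" "h 2 \<le> m" "set js \<subseteq> level m"
      have eq: "k 2 = h 2" using moved[OF h(2,3,5)] moved[OF k(2,3,5)] prod h k by simp
      have c: "set (fakes ks) \<subseteq> carrier S" "set (fakes js) \<subseteq> carrier S"
        using k h level_closed[of m] by auto
      have "word_prod S (fakes ks) = word_prod S (fakes js)"
        using prod c k h eq fake_transpose_closed[OF h(2)] by (simp add: word_prod_fake)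
      then have "fakes ks \<triangleq> fakes js"
        using Suc k h gs' hs' by simp
      moreover have "fake k \<triangleq> fake h" using k h eq by (intro fake_cong) auto
      ultimately show ?thesis using k h by (simp add: eqR_append)
    qed
  qed
  then show ?case using gs'(2) hs'(2) eqR_sym eqR_trans by blast
qed

lemma fakes_unique:
  assumes "set gs \<subseteq> carrier S" "set hs \<subseteq> carrier S" "length gs = length hs"
    and "word_prod S (fakes gs) = word_prod S (fakes hs)"
  shows "fakes gs \<triangleq> fakes hs"
proof -
  have "carrier S \<subseteq> level d"
    using carrier_range d by (force simp: level_def)
  then show ?thesis using assms d by (intro fakes_level_unique[of d]) auto
qed


section \<open>Normalizing the remaining letters\<close>

lemma fakes_product_exists:
  assumes "1 \<le> m" "m \<le> d" "h permutes {1..m}"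
  shows "\<exists>bs. set bs \<subseteq> carrier S \<and> length bs \<le> m - 1 \<and> word_prod S (fakes bs) = h"
  using assms
proof (induction m arbitrary: h rule: nat_induct_at_least)
  case base
  then have "h = id" by (simp add: permutes_sing)
  then show ?case by (intro exI[of _ "[]"]) (auto simp: S_one)
next
  case (Suc m)
  have h: "h permutes insert (Suc m) {1..m}"
    using Suc.prems(2) by (simp add: atLeastAtMostSuc_conv)
  have hm: "h (Suc m) \<in> {1..Suc m}"
    using permutes_in_image[OF Suc.prems(2), of "Suc m"] by simp
  show ?case
  proof (cases "h (Suc m) = Suc m")
    case True
    have "transpose (Suc m) (h (Suc m)) \<circ> h permutes {1..m}"
      using h by (rule permutes_insert_lemma)
    then have "h permutes {1..m}" using True by simp
    then obtain bs where "set bs \<subseteq> carrier S" "length bs \<le> m - 1" "word_prod S (fakes bs) = h"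
      using Suc.IH Suc.prems(1) by auto
    then show ?thesis by (intro exI[of _ bs]) auto
  next
    case False
    let ?t = "transpose (Suc m) (h (Suc m))"
    have "?t \<circ> h permutes {1..m}" using h by (rule permutes_insert_lemma)
    then obtain bs where bs: "set bs \<subseteq> carrier S" "length bs \<le> m - 1"
        "word_prod S (fakes bs) = ?t \<circ> h"
      using Suc.IH Suc.prems(1) by auto
    let ?f = "\<lambda>k::nat. if k = 1 then Suc m else h (Suc m)"
    have "\<exists>p. p permutes {1..d} \<and> (\<forall>x\<in>{1, 2}. p x = ?f x)"
      using False hm Suc.prems(1) d by (intro permutes_extension) auto
    then obtain p where p: "p \<in> carrier S" "p 1 = Suc m" "p 2 = h (Suc m)"
      by (auto simp: sym_group_carrier)
    have "word_prod S (fakes (p # bs)) = ?t \<circ> (?t \<circ> h)"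
      using p bs by (simp add: word_prod_fake S_mult)
    also have "\<dots> = h" by (simp add: o_assoc)
    finally show ?thesis using p bs Suc.hyps by (intro exI[of _ "p # bs"]) auto
  qed
qed

lemma evenperm_fakes:
  "set gs \<subseteq> carrier S \<Longrightarrow> evenperm (word_prod S (fakes gs)) = even (length gs)"
proof (induction gs)
  case (Cons g gs)
  then have c: "g \<in> carrier S" "set gs \<subseteq> carrier S" by auto
  have "g 1 \<noteq> g 2" using carrier_inj[OF c(1)] by simp
  moreover have "permutation (word_prod S (fakes gs))"
    using sym_group_carrier'[of _ d] c by simp
  moreover have "word_prod S (fakes (g # gs)) = transpose (g 1) (g 2) \<circ> word_prod S (fakes gs)"
    using c by (simp add: word_prod_fake S_mult)
  ultimately show ?case
    using Cons.IH c by (simp only: evenperm_comp permutation_swap_id evenperm_swap) simp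
qed (simp add: S_one)

text \<open>Short products are lengthened by pairs of equal fake transpositions, whose product is one.\<close>

lemma fakes_product_exists_length:
  assumes p: "p \<in> carrier S" and l: "d - 1 \<le> l" "evenperm p = even l"
  shows "\<exists>bs. set bs \<subseteq> carrier S \<and> length bs = l \<and> word_prod S (fakes bs) = p"
proof -
  obtain bs where bs: "set bs \<subseteq> carrier S" "length bs \<le> d - 1" "word_prod S (fakes bs) = p"
    using fakes_product_exists[of d p] d p by (auto simp: sym_group_carrier)
  have "even (l - length bs)"
    using evenperm_fakes[OF bs(1)] bs l by auto
  then obtain k where k: "l - length bs = 2 * k" by blast
  let ?pad = "replicate (2 * k) \<one>\<^bsub>S\<^esub>"
  have pc: "set ?pad \<subseteq> carrier S" by auto
  have "transpose 1 2 \<in> carrier S" using w_closed w_prod by (metis word_prod_closed)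
  moreover have "transpose 1 2 \<otimes>\<^bsub>S\<^esub> transpose 1 2 = \<one>\<^bsub>S\<^esub>" by (simp add: S_mult S_one)
  ultimately have "word_prod S (fakes ?pad) = \<one>\<^bsub>S\<^esub>"
    using w_closed by (induction k) (auto simp: fake_one w_prod m_assoc[symmetric])
  then have "word_prod S (fakes (bs @ ?pad)) = p"
    using bs pc p by simp
  moreover have "length (bs @ ?pad) = l" using k bs(2) l(1) by simp
  ultimately show ?thesis using bs(1) pc by (intro exI[of _ "bs @ ?pad"]) auto
qed

text \<open>With $2(d-1)$ factors there is room to split off an arbitrary permutation \<open>h\<close> at the right: at most
  $d-1$ transpositions give \<open>h\<close>, the remaining ones give the complementary factor, and parity takes
  care of itself.\<close>

lemma fakes_factor:
  assumes gs: "set gs \<subseteq> carrier S" "2 * (d - 1) \<le> length gs" and h: "h \<in> carrier S"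
  shows "\<exists>as bs. set as \<subseteq> carrier S \<and> set bs \<subseteq> carrier S \<and> length as + length bs = length gs \<and>
    word_prod S (fakes bs) = h \<and> fakes gs \<triangleq> fakes as @ fakes bs"
proof -
  obtain bs where bs: "set bs \<subseteq> carrier S" "length bs \<le> d - 1" "word_prod S (fakes bs) = h"
    using fakes_product_exists[of d h] d h by (auto simp: sym_group_carrier)
  let ?g = "word_prod S (fakes gs)"
  let ?p = "?g \<otimes>\<^bsub>S\<^esub> inv\<^bsub>S\<^esub> h"
  have g: "?g \<in> carrier S" using gs(1) by simp
  have pc: "?p \<in> carrier S" using g h by simp
  have "?g = ?p \<circ> h" using g h by (simp add: S_mult[symmetric] m_assoc)
  then have "evenperm ?g = (evenperm ?p = evenperm h)"
    using evenperm_comp[OF sym_group_carrier'[OF pc] sym_group_carrier'[OF h]] by simp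
  then have room: "evenperm ?p = even (length gs - length bs)" "d - 1 \<le> length gs - length bs"
    using evenperm_fakes[OF gs(1)] evenperm_fakes[OF bs(1)] bs gs(2) by auto
  then obtain as where as: "set as \<subseteq> carrier S" "length as = length gs - length bs"
      "word_prod S (fakes as) = ?p"
    using fakes_product_exists_length[OF pc, of "length gs - length bs"] room by blast
  have "fakes gs \<triangleq> fakes (as @ bs)"
    using gs as bs g h by (intro fakes_unique) (auto simp: m_assoc)
  then show ?thesis using as bs gs(2) by (intro exI[of _ as] exI[of _ bs]) auto
qed

text \<open>A letter that passes a word with product \<open>h\<close> is conjugated by \<open>h\<close>.  Splitting off a suitable \<open>h\<close> turns
  it into any chosen member of its class; the change of the product is absorbed by the fake
  transpositions.\<close>

lemma replace_letter:
  assumes gs: "set gs \<subseteq> carrier S" "2 * (d - 1) \<le> length gs"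
    and z: "z \<in> carrier S" and y: "y \<in> conj_class S z"
  shows "\<exists>hs. set hs \<subseteq> carrier S \<and> length hs = length gs \<and> fakes gs @ [z] \<triangleq> [y] @ fakes hs"
proof -
  obtain h where h: "h \<in> carrier S" "h \<otimes>\<^bsub>S\<^esub> z \<otimes>\<^bsub>S\<^esub> inv\<^bsub>S\<^esub> h = y"
    using y by (auto simp: conj_class_def)
  obtain as bs where ab: "set as \<subseteq> carrier S" "set bs \<subseteq> carrier S"
      "length as + length bs = length gs" "word_prod S (fakes bs) = h"
      "fakes gs \<triangleq> fakes as @ fakes bs"
    using fakes_factor[OF gs h(1)] by blast
  have yc: "y \<in> carrier S" using h z by auto
  let ?as = "map (\<lambda>g. inv\<^bsub>S\<^esub> y \<otimes>\<^bsub>S\<^esub> g) as"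
  have asc: "set ?as \<subseteq> carrier S" using ab(1) yc by auto
  have "fakes gs @ [z] \<triangleq> fakes as @ fakes bs @ [z]"
    using eqR_appendR[OF ab(5), of "[z]"] z by simp
  also have "\<dots> \<doteq> fakes as @ [y] @ fakes bs"
    using word_eq_appendL[OF word_swap'[of "fakes bs" "[z]"], of "fakes as"] ab z h by simp
  also have "\<dots> \<doteq> [y] @ fakes ?as @ fakes bs"
    using word_eq_appendR[OF word_past_letter[of "fakes as" y], of "fakes bs"] ab yc
    by (simp add: conj_word_fakes)
  finally have "fakes gs @ [z] \<triangleq> [y] @ fakes (?as @ bs)" by simp
  then show ?thesis using asc ab by (intro exI[of _ "?as @ bs"]) auto
qed

lemma conj_word_no_one:
  "g \<in> carrier S \<Longrightarrow> set q \<subseteq> carrier S \<Longrightarrow> \<one>\<^bsub>S\<^esub> \<in> set (conj_word g q) \<longleftrightarrow> \<one>\<^bsub>S\<^esub> \<in> set q"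
  by (induction q) (auto simp: full.conj_eq_one_iff eq_commute[of "\<one>\<^bsub>S\<^esub>"])

text \<open>Thus the letters of \<open>q\<close> can be converted, one by one and in any order of the classes, into those of
  a prescribed word \<open>ys\<close> of the same type.\<close>

lemma normalize_word:
  assumes "set gs \<subseteq> carrier S" "2 * (d - 1) \<le> length gs"
    and "set q \<subseteq> carrier S - {\<one>\<^bsub>S\<^esub>}" "set ys \<subseteq> carrier S - {\<one>\<^bsub>S\<^esub>}"
    and "word_type S q = word_type S ys"
  shows "\<exists>hs. set hs \<subseteq> carrier S \<and> length hs = length gs \<and> fakes gs @ q \<triangleq> ys @ fakes hs"
  using assms
proof (induction ys arbitrary: gs q)
  case Nil
  then have "q = []" by (cases q) (auto simp: word_type_def)
  then show ?case using Nil by (intro exI[of _ gs]) auto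
next
  case (Cons y ys)
  have "conj_class S y \<in># word_type S q" using Cons.prems by (simp add: word_type_def)
  then obtain z where z: "z \<in> set q" "conj_class S z = conj_class S y"
    by (auto simp: word_type_def)
  obtain q1 q2 where q: "q = q1 @ z # q2" using z split_list by metis
  have c: "z \<in> carrier S" "set q1 \<subseteq> carrier S" "set q2 \<subseteq> carrier S" "y \<in> carrier S"
      "z \<noteq> \<one>\<^bsub>S\<^esub>" "y \<noteq> \<one>\<^bsub>S\<^esub>" "\<one>\<^bsub>S\<^esub> \<notin> set q1" "\<one>\<^bsub>S\<^esub> \<notin> set q2"
    using Cons.prems q by auto
  let ?q = "conj_word (inv\<^bsub>S\<^esub> z) q1 @ q2"
  have qc: "set ?q \<subseteq> carrier S" using c by simp
  have "set ?q \<subseteq> carrier S - {\<one>\<^bsub>S\<^esub>}"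
    using c conj_word_no_one[of "inv\<^bsub>S\<^esub> z" q1] by (simp add: subset_Diff_insert)
  moreover have "word_type S ?q = word_type S ys"
  proof -
    have cons: "word_type S (x # v) = add_mset (conj_class S x) (word_type S v)"
      if "x \<noteq> \<one>\<^bsub>S\<^esub>" for x v
      using that by (simp add: word_type_def)
    show ?thesis
      using Cons.prems(5) c z(2) unfolding q by (simp add: cons word_type_conj_word)
  qed
  moreover have "y \<in> conj_class S z" using conj_class_self[OF c(4)] z(2) by simp
  then obtain ks where ks: "set ks \<subseteq> carrier S" "length ks = length gs"
      "fakes gs @ [z] \<triangleq> [y] @ fakes ks"
    using replace_letter[OF Cons.prems(1,2) c(1)] by blast
  ultimately obtain hs where hs: "set hs \<subseteq> carrier S" "length hs = length gs"
      "fakes ks @ ?q \<triangleq> ys @ fakes hs"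
    using Cons.IH[of ks ?q] Cons.prems by auto
  have "fakes gs @ q \<doteq> fakes gs @ [z] @ ?q"
    unfolding q using word_eq_appendL[OF word_pull[of q1 z q2], of "fakes gs"] c Cons.prems(1)
    by simp
  also have "\<dots> \<triangleq> [y] @ fakes ks @ ?q"
    using eqR_appendR[OF ks(3) qc] by simp
  also have "\<dots> \<triangleq> [y] @ ys @ fakes hs"
    using hs(3) c by (intro eqR_appendL) auto
  finally show ?case using hs by (intro exI[of _ hs]) auto
qed

text \<open>After both remainders have been converted into the same word, the fake transpositions have equal
  length and equal product.\<close>

lemma normal_form_unique:
  assumes gs: "set gs \<subseteq> carrier S" "2 * (d - 1) \<le> length gs"
    and hs: "set hs \<subseteq> carrier S" "length hs = length gs"
    and q: "set q \<subseteq> carrier S" and q': "set q' \<subseteq> carrier S"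
    and type: "word_type S q = word_type S q'"
    and prod: "word_prod S (fakes gs @ q) = word_prod S (fakes hs @ q')"
  shows "fakes gs @ q \<triangleq> fakes hs @ q'"
proof -
  let ?f = "filter (\<lambda>x. x \<noteq> \<one>\<^bsub>S\<^esub>)"
  have "w \<noteq> []"
  proof
    assume "w = []"
    then have "transpose 1 2 = (id :: nat \<Rightarrow> nat)" using w_prod by (simp add: S_one)
    from fun_cong[OF this, of 1] show False by simp
  qed
  then have ne: "fakes ks \<noteq> []" if "length ks = length gs" for ks
    using that gs(2) d by (cases ks) (auto simp: fake_def)
  have fq: "fakes gs @ q \<doteq> fakes gs @ ?f q" "fakes hs @ q' \<doteq> fakes hs @ ?f q'"
    by (rule word_delete_ones; use gs hs q q' ne in simp)+
  have c: "set (?f q) \<subseteq> carrier S - {\<one>\<^bsub>S\<^esub>}" "set (?f q') \<subseteq> carrier S - {\<one>\<^bsub>S\<^esub>}"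
    using q q' by auto
  have t: "word_type S (?f q) = word_type S (?f q')"
    using type by (simp add: word_type_def filter_filter_mset)
  obtain gs' where gs': "set gs' \<subseteq> carrier S" "length gs' = length gs"
      "fakes gs @ ?f q \<triangleq> ?f q @ fakes gs'"
    using normalize_word[OF gs c(1) c(1)] by auto
  obtain hs' where hs': "set hs' \<subseteq> carrier S" "length hs' = length gs"
      "fakes hs @ ?f q' \<triangleq> ?f q @ fakes hs'"
    using normalize_word[OF hs(1) _ c(2) c(1)] hs(2) gs(2) t by auto
  have G: "fakes gs @ q \<triangleq> ?f q @ fakes gs'" by (rule eqR_word_eq_trans(2)[OF fq(1) gs'(3)])
  have H: "fakes hs @ q' \<triangleq> ?f q @ fakes hs'" by (rule eqR_word_eq_trans(2)[OF fq(2) hs'(3)])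
  have fc: "set (?f q) \<subseteq> carrier S" using q by auto
  have "word_prod S (?f q @ fakes gs') = word_prod S (?f q @ fakes hs')"
    using eqR_prod[OF G] eqR_prod[OF H] prod by simp
  then have "word_prod S (fakes gs') = word_prod S (fakes hs')"
    using word_prod_closed[OF fc] word_prod_closed[OF fakes_closed[OF gs'(1)]]
      word_prod_closed[OF fakes_closed[OF hs'(1)]]
    by (simp only: word_prod_append[OF fc fakes_closed[OF gs'(1)]]
        word_prod_append[OF fc fakes_closed[OF hs'(1)]] l_cancel)
  then have "fakes gs' \<triangleq> fakes hs'"
    using gs' hs' by (intro fakes_unique) auto
  then have "?f q @ fakes gs' \<triangleq> ?f q @ fakes hs'"
    using q by (intro eqR_appendL) auto
  from eqR_trans[OF G eqR_trans[OF this eqR_sym[OF H]]] show ?thesis .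
qed

end


section \<open>Words with many letters in the class\<close>

locale transposition_word_class = group "sym_group d" for d +
  fixes \<sigma> :: "nat \<Rightarrow> nat" and w :: "(nat \<Rightarrow> nat) list" and n :: nat
  assumes d: "4 \<le> d"
    and \<sigma>: "\<sigma> \<in> carrier (sym_group d)" "\<sigma> \<noteq> \<one>\<^bsub>sym_group d\<^esub>"
    and n: "0 < n" "\<sigma> [^]\<^bsub>sym_group d\<^esub> n = \<one>\<^bsub>sym_group d\<^esub>"
    and w_class: "set w \<subseteq> conj_class (sym_group d) \<sigma>"
    and w_prod: "word_prod (sym_group d) w = transpose 1 2"
    and w_fix: "\<And>x. x \<in> set w \<Longrightarrow> x (d - 1) = d - 1 \<and> x d = d"
begin

notation word_eq (infix "\<doteq>" 50)

abbreviation S where "S \<equiv> sym_group d"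
abbreviation C where "C \<equiv> conj_class S \<sigma>"

text \<open>Fake transpositions over $(1\,2), (1\,3), \dots, (1\,d)$.\<close>

definition star :: "(nat \<Rightarrow> nat) list"
  where "star = concat (map (\<lambda>i. conj_word (transpose 2 i) w) [2..<Suc d])"

lemma torsion_class: "C \<subseteq> torsion n" "C \<subseteq> carrier S"
  using conj_class_torsion[of \<sigma> n] \<sigma> n conj_class_closed by (auto simp: torsion_def)

lemma w_closed: "set w \<subseteq> carrier S"
  using w_class torsion_class by blast

lemma w_nonempty: "w \<noteq> []"
proof
  assume "w = []"
  then have "transpose 1 2 = (id :: nat \<Rightarrow> nat)" using w_prod by (simp add: sym_group_one)
  from fun_cong[OF this, of 1] show False by simp
qed

lemma star_class: "set star \<subseteq> C"
proof -
  have "set (conj_word (transpose 2 i) w) \<subseteq> C" if "i \<in> set [2..<Suc d]" for i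
    using that d \<sigma>(1) w_class by (intro conj_word_conj_class transpose_in_sym_group) auto
  then show ?thesis by (auto simp: star_def)
qed

lemma length_star: "length star = (d - 1) * length w"
proof -
  have "length star = sum_list (map (\<lambda>_. length w) [2..<Suc d])"
    by (simp add: star_def length_concat o_def del: upt_Suc)
  also have "\<dots> = (d - 1) * length w" by (simp add: sum_list_triv del: upt_Suc)
  finally show ?thesis .
qed

lemma star_generate: "generate S (set star) = carrier S"
proof
  have c: "set star \<subseteq> carrier S" using star_class torsion_class by blast
  then show "generate S (set star) \<subseteq> carrier S" by (rule generate_incl)
  show "carrier S \<subseteq> generate S (set star)"
  proof (rule transpositions_generate)
    show H: "subgroup (generate S (set star)) S" using c by (rule generate_is_subgroup)
    show "1 \<le> d" using d by simp
    fix i assume i: "2 \<le> i" "i \<le> d"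
    have t: "transpose 2 i \<in> carrier S" using i d by (intro transpose_in_sym_group) auto
    have "set (conj_word (transpose 2 i) w) \<subseteq> set star"
      using i by (auto simp: star_def simp del: upt_Suc intro!: bexI[of _ i])
    also have "\<dots> \<subseteq> generate S (set star)" by (auto intro: generate.incl)
    finally have "word_prod S (conj_word (transpose 2 i) w) \<in> generate S (set star)"
      by (rule word_prod_in_subgroup[OF H])
    also have "word_prod S (conj_word (transpose 2 i) w) =
        transpose (transpose 2 i 1) (transpose 2 i 2)"
      using t w_closed
      by (simp only: word_prod_conj_word w_prod sym_group_conj_transpose)
    finally show "transpose 1 i \<in> generate S (set star)" using i by simp
  qed
qed

text \<open>Two copies of the star, so that each of them can be conjugated by means of the other.\<close>

definition R :: "(nat \<Rightarrow> nat) list"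
  where "R = blocks n (star @ star)"

lemma fake_transpositions: "fake_transpositions d w R"
proof
  have c: "set star \<subseteq> torsion n" "set star \<subseteq> carrier S" using star_class torsion_class by blast+
  have set: "set (blocks n star) = set star" using n(1) by simp
  show "4 \<le> d" by (rule d)
  show "set w \<subseteq> carrier S" by (rule w_closed)
  show "word_prod S w = transpose 1 2" by (rule w_prod)
  show "x (d - 1) = d - 1 \<and> x d = d" if "x \<in> set w" for x using w_fix[OF that] .
  show "set R \<subseteq> carrier S" using c by (simp add: R_def)
  show "word_prod S R = \<one>\<^bsub>S\<^esub>" using c unfolding R_def by (intro word_prod_blocks) auto
  show "generate S (set R) = carrier S" using star_generate set by (simp add: R_def)
  show "R \<doteq> conj_word g R" if "g \<in> carrier S" for g
    using double_word_conj[of "blocks n star" g] that c set star_generate word_prod_blocks[OF c(1)]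
    by (simp add: R_def)
  obtain rest where rest: "set rest \<subseteq> carrier S" "R \<doteq> (star @ star) @ rest"
    using blocks_split[OF n(1), of "star @ star"] c unfolding R_def by auto
  have "[2..<Suc d] = 2 # [3..<Suc d]" using d by (simp add: upt_conv_Cons)
  then have "star = conj_word id w @ concat (map (\<lambda>i. conj_word (transpose 2 i) w) [3..<Suc d])"
    by (simp add: star_def del: upt_Suc)
  moreover have "conj_word id w = w" using conj_word_one[OF w_closed] by (simp only: sym_group_one)
  ultimately obtain star' where "star = w @ star'" by simp
  then have "R \<doteq> w @ (star' @ star @ rest)" using rest by simp
  then show "\<exists>rest. R \<doteq> w @ rest" by blast
qed

text \<open>Let $m$ be the length of \<open>w\<close>.  The word contains $d(d-1)m$ blocks.  The first $2(d-1)m$ of them become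
  \<open>R\<close>, the next $2(d-1)m$ yield $2(d-1)$ copies of \<open>w\<close>, and any others are moved to the remainder.
  At most $(d-1)^2$ blocks are held back to generate the group together with the remainder, which
  leaves the $(d-1)m$ blocks of one copy of \<open>star\<close>.\<close>

lemma standard_prefix:
  assumes u: "set u \<subseteq> carrier S" "generate S (set u) = carrier S"
    and count: "d * (d - 1) * length w * n + n * card C \<le> count (word_type S u) C"
  shows "\<exists>q. set q \<subseteq> carrier S \<and> u \<doteq> R @ concat (replicate (2 * (d - 1)) w) @ q"
proof -
  let ?K = "d * (d - 1) * length w"
  let ?T = "concat (replicate (2 * (d - 1)) w)"
  have lw: "1 \<le> length w" using w_nonempty by (cases w) auto
  have finC: "finite C" using torsion_class(2) finite_sym_group finite_subset by blast
  obtain gs q where gs: "length gs = ?K" "set gs \<subseteq> C" "set q \<subseteq> carrier S" "u \<doteq> blocks n gs @ q"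
    using extract_blocks[OF finC \<sigma> n(1) u(1) count] by blast
  have gen: "generate S (set gs \<union> set q) = carrier S"
    using word_eq_generate[OF gs(4)] u(2) n(1) by simp
  define pad where "pad = replicate (?K - 4 * (d - 1) * length w) \<sigma>"
  have "4 * (d - 1) * length w \<le> ?K" using d by (intro mult_right_mono) auto
  moreover have "length (star @ star @ ?T) = 4 * (d - 1) * length w"
    by (simp add: length_star length_concat sum_list_replicate algebra_simps)
  ultimately have len: "length (star @ star @ ?T @ pad) = ?K"
    unfolding pad_def length_append length_replicate by linarith
  have TC: "set ?T \<subseteq> C" using w_class by auto
  have padC: "set pad \<subseteq> C" using conj_class_self[OF \<sigma>(1)] by (auto simp: pad_def)
  have room: "r + length star \<le> length gs" if r: "2 ^ r \<le> order S" for r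
  proof -
    have "(2::nat) ^ r \<le> fact d" using r by (simp add: order_sym_group)
    also have "\<dots> \<le> 2 ^ (d - 1)\<^sup>2" using d by (intro fact_le_power_square) simp
    finally have "(2::nat) ^ r \<le> 2 ^ (d - 1)\<^sup>2" .
    then have "r \<le> (d - 1)\<^sup>2" by (rule power_le_imp_le_exp[rotated]) simp
    also have "\<dots> \<le> (d - 1)\<^sup>2 * length w" using lw by simp
    finally have "r + length star \<le> (d - 1)\<^sup>2 * length w + (d - 1) * length w"
      by (simp add: length_star)
    also have "\<dots> = ?K" using d by (cases d) (simp_all add: power2_eq_square algebra_simps)
    finally show ?thesis using gs(1) by simp
  qed
  have "blocks n gs @ q \<doteq> blocks n (star @ star @ ?T @ pad) @ q"
    using \<sigma> n torsion_class gs gen star_class star_generate TC padC len room finite_sym_group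
    by (intro blocks_free[of \<sigma>]) (auto simp: torsion_def)
  also have "\<dots> = R @ blocks n ?T @ blocks n pad @ q" by (simp add: R_def)
  finally have 1: "blocks n gs @ q \<doteq> R @ blocks n ?T @ blocks n pad @ q" .
  obtain rest where rest: "set rest \<subseteq> carrier S" "blocks n ?T \<doteq> ?T @ rest"
    using blocks_split[OF n(1), of ?T] TC torsion_class by blast
  have c: "set R \<subseteq> carrier S" "set (blocks n pad @ q) \<subseteq> carrier S"
    using star_class padC torsion_class gs(3) by (auto simp: R_def n(1))
  have "R @ blocks n ?T @ blocks n pad @ q \<doteq> R @ ?T @ rest @ blocks n pad @ q"
    using word_eq_appendL[OF word_eq_appendR[OF rest(2) c(2)] c(1)] by simp
  from word_eq_trans[OF gs(4) word_eq_trans[OF 1 this]] show ?thesis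
    using rest c by (intro exI[of _ "rest @ blocks n pad @ q"]) auto
qed

lemma words_equivalent:
  assumes u: "set u \<subseteq> carrier S" "generate S (set u) = carrier S"
    and v: "set v \<subseteq> carrier S" "generate S (set v) = carrier S"
    and type: "word_type S u = word_type S v" and prod: "word_prod S u = word_prod S v"
    and count: "d * (d - 1) * length w * n + n * card C \<le> count (word_type S u) C"
  shows "u \<doteq> v"
proof -
  interpret F: fake_transpositions d w R by (rule fake_transpositions)
  let ?gs = "replicate (2 * (d - 1)) \<one>\<^bsub>S\<^esub>"
  have fk: "F.fakes ?gs = concat (replicate (2 * (d - 1)) w)"
    by (simp add: F.fakes_def F.fake_one)
  obtain p where p: "set p \<subseteq> carrier S" "u \<doteq> R @ F.fakes ?gs @ p"
    using standard_prefix[OF u count] fk by auto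
  obtain q where q: "set q \<subseteq> carrier S" "v \<doteq> R @ F.fakes ?gs @ q"
    using standard_prefix[OF v] count type fk by auto
  have gsc: "set ?gs \<subseteq> carrier S" by auto
  have "word_type S p = word_type S q"
    using word_eq_type[OF p(2)] word_eq_type[OF q(2)] type by simp
  moreover have "word_prod S (F.fakes ?gs @ p) = word_prod S (F.fakes ?gs @ q)"
    using word_eq_prod[OF p(2)] word_eq_prod[OF q(2)] prod p(1) q(1) gsc F.R_closed F.R_prod
    by simp
  ultimately have "F.eqR (F.fakes ?gs @ p) (F.fakes ?gs @ q)"
    using p(1) q(1) gsc by (intro F.normal_form_unique) auto
  then have "R @ F.fakes ?gs @ p \<doteq> R @ F.fakes ?gs @ q" by (simp add: F.eqR_def)
  from word_eq_trans[OF word_eq_trans[OF p(2) this] word_eq_sym[OF q(2)]] show ?thesis .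
qed

end

lemma Sigma_sym_word:
  assumes "s \<in> Sigma_sym d"
  shows "\<exists>w. w \<noteq> [] \<and> set w \<subseteq> carrier (sym_group d) \<and>
    s = fact_rel (sym_group d) (carrier (sym_group d)) `` {w}"
  using assms unfolding Sigma_sym_def fact_semigroup_def by (auto elim!: quotientE)

lemma Sigma_class_word:
  assumes "s \<in> Sigma_class d C" "C \<subseteq> carrier (sym_group d)"
  shows "\<exists>w. w \<noteq> [] \<and> set w \<subseteq> C \<and>
    s = fact_rel (sym_group d) (carrier (sym_group d)) `` {w}"
  using assms(1) unfolding Sigma_class_def
proof (induction rule: fact_sub.induct)
  case (gen g)
  then show ?case by (intro exI[of _ "[g]"]) (auto simp: fact_gen_def)
next
  case (mult s t)
  then obtain u v where u: "u \<noteq> []" "set u \<subseteq> C"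
      "s = fact_rel (sym_group d) (carrier (sym_group d)) `` {u}"
    and v: "v \<noteq> []" "set v \<subseteq> C"
      "t = fact_rel (sym_group d) (carrier (sym_group d)) `` {v}" by blast
  have "fact_mult (sym_group d) (carrier (sym_group d)) s t =
      fact_rel (sym_group d) (carrier (sym_group d)) `` {u @ v}"
    unfolding u(3) v(3) using u v assms(2)
    by (intro factorization_semigroup.fact_mult_class[OF factorization_semigroup_sym_group]) auto
  then show ?case using u v by (intro exI[of _ "u @ v"]) auto
qed

theorem theorem1:
  fixes d :: nat and \<sigma> :: "nat \<Rightarrow> nat"
  assumes "\<sigma> \<in> carrier (sym_group d)"
    and "\<not> evenperm \<sigma>"
    and "class_fixed d \<sigma> \<ge> 2"
  shows "\<exists>N::nat.
      N < 3 ^ (d - 3) * (2 * d - 1) * (d - 1) * class_transp_length d \<sigma>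
          + class_order d \<sigma> * class_card d \<sigma> + 1 \<and>
      (\<forall>s1 \<in> Sigma_sym d. \<forall>s2 \<in> Sigma_class d (conj_class (sym_group d) \<sigma>).
        \<forall>s s'.
          s = Sigma_mult d s1 s2 \<longrightarrow>
          s \<in> Sigma_full d \<longrightarrow>
          fact_length (sym_group d) s2 \<ge> N \<longrightarrow>
          s' \<in> Sigma_full d \<longrightarrow>
          fact_type (sym_group d) s' = fact_type (sym_group d) s \<longrightarrow>
          fact_alpha (sym_group d) s' = fact_alpha (sym_group d) s \<longrightarrow>
          s' = s)"
proof -
  let ?S = "sym_group d" and ?C = "conj_class (sym_group d) \<sigma>"
  let ?n = "class_order d \<sigma>" and ?m = "class_transp_length d \<sigma>"
  interpret FS: factorization_semigroup ?S "carrier ?S" by (rule factorization_semigroup_sym_group)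
  have d: "4 \<le> d" by (rule odd_perm_two_fixed_points[OF assms])
  have "\<exists>m w. length w = m \<and> set w \<subseteq> ?C \<inter> {p \<in> carrier ?S. p (d - 1) = d - 1 \<and> p d = d} \<and>
      word_prod ?S w = transpose 1 2"
    using transposition_word_exists[OF assms] by blast
  from LeastI_ex[OF this] obtain w where w: "length w = ?m"
      "set w \<subseteq> ?C \<inter> {p \<in> carrier ?S. p (d - 1) = d - 1 \<and> p d = d}"
      "word_prod ?S w = transpose 1 2"
    unfolding class_transp_length_def by blast
  have "\<sigma> \<noteq> \<one>\<^bsub>?S\<^esub>" using assms(2) by (auto simp: sym_group_one)
  then interpret K: transposition_word_class d \<sigma> w ?n
    using d assms(1) class_order_bound[OF assms] w by unfold_locales auto
  let ?N = "d * (d - 1) * ?m * ?n + ?n * card ?C"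
  have "d * (d - 1) * ?m * ?n = (d * ?n) * ((d - 1) * ?m)" by simp
  also have "\<dots> \<le> (3 ^ (d - 3) * (2 * d - 1)) * ((d - 1) * ?m)"
    using block_count_bound[OF d class_order_bound(2)[OF assms]] by (rule mult_right_mono) simp
  finally have "d * (d - 1) * ?m * ?n \<le> 3 ^ (d - 3) * (2 * d - 1) * (d - 1) * ?m"
    by (simp only: mult.assoc)
  then have N: "?N < 3 ^ (d - 3) * (2 * d - 1) * (d - 1) * ?m + ?n * class_card d \<sigma> + 1"
    unfolding class_card_def by linarith
  have "s' = s"
    if s1: "s1 \<in> Sigma_sym d" and s2: "s2 \<in> Sigma_class d ?C"
      and s: "s = Sigma_mult d s1 s2" "s \<in> Sigma_full d" and len: "?N \<le> fact_length ?S s2"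
      and s': "s' \<in> Sigma_full d" and type: "fact_type ?S s' = fact_type ?S s"
      and alpha: "fact_alpha ?S s' = fact_alpha ?S s" for s1 s2 s s'
  proof -
    let ?cl = "\<lambda>u. fact_rel ?S (carrier ?S) `` {u}"
    obtain w1 where w1: "w1 \<noteq> []" "set w1 \<subseteq> carrier ?S" "s1 = ?cl w1"
      using Sigma_sym_word[OF s1] by blast
    obtain w2 where w2: "w2 \<noteq> []" "set w2 \<subseteq> ?C" "s2 = ?cl w2"
      using Sigma_class_word[OF s2 K.torsion_class(2)] by blast
    have w2c: "set w2 \<subseteq> carrier ?S" using w2(2) K.torsion_class(2) by blast
    let ?u = "w1 @ w2"
    have u: "?u \<noteq> []" "set ?u \<subseteq> carrier ?S" "s = ?cl ?u"
      using w1 w2 w2c s(1) FS.fact_mult_class[OF w1(1,2) w2(1) w2c] by (auto simp: Sigma_mult_def)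
    obtain v where v: "v \<noteq> []" "set v \<subseteq> carrier ?S" "s' = ?cl v"
      using Sigma_sym_word[of s' d] s' unfolding Sigma_full_def by blast
    have gen: "generate ?S (set ?u) = carrier ?S" "generate ?S (set v) = carrier ?S"
      using s(2) s' FS.fact_subgroup_class[OF u(1,2)] FS.fact_subgroup_class[OF v(1,2)] u(3) v(3)
      by (simp_all add: Sigma_full_def)
    have "fact_length ?S s2 = size (word_type ?S w2)"
      using FS.fact_type_class[OF w2(1) w2c] w2(3) by (simp add: fact_length_def)
    also have "\<dots> \<le> length w2" by (simp add: word_type_def size_filter_mset_lesseq flip: size_mset)
    also have "length w2 = length (filter (\<lambda>x. x \<in> ?C) w2)"
      using w2(2) by (simp add: filter_True subset_iff)
    also have "\<dots> = count (word_type ?S w2) ?C"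
      using FS.count_word_type[OF assms(1) K.\<sigma>(2) w2c] by simp
    also have "\<dots> \<le> count (word_type ?S ?u) ?C" by simp
    finally have "?N \<le> count (word_type ?S ?u) ?C" using len by simp
    then have "FS.word_eq ?u v"
      using u v gen type alpha FS.fact_type_class[OF u(1,2)] FS.fact_type_class[OF v(1,2)]
        FS.fact_alpha_class[OF u(1,2)] FS.fact_alpha_class[OF v(1,2)] w(1)
      by (intro K.words_equivalent) auto
    then have "(?u, v) \<in> fact_rel ?S (carrier ?S)"
      using FS.word_eq_imp_fact_cong u(1) by (simp add: fact_rel_def)
    from equiv_class_eq[OF FS.equiv_fact_rel this] show ?thesis using u(3) v(3) by simp
  qed
  with N show ?thesis by blast
qed

end
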